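(* Let $(R,\mathfrak{m})$ be a noetherian local ring and let $\hat{R}$ denote its $\mathfrak{m}$-adic completion. Then $i(R)=i(\hat{R})$.
   Context: All rings are commutative with identity. For an ideal $J$ of a noetherian ring $R$, an element $x\in R$ is integral over $J$ if $x^n+a_1x^{n-1}+\cdots+a_n=0$ for some $n\geq 1$ and $a_i\in J^i$ ($1\le i\le n$); the integral closure $\overline{J}$ is the ideal of all elements integral over $J$. The integral dimension $i(R)$ of a noetherian ring $R$ is the least integer $k\geq 0$ such that $(\overline{J})^n\subseteq J^{n-k}$ for all ideals $J$ of $R$ and all $n\geq k$ (with $J^0=R$), if such a $k$ exists; otherwise $i(R)=\infty$. *)

theory Defs
  imports
    "HOL-Algebra.Ideal_Product"
    "HOL-Algebra.QuotRing"
    "HOL-Algebra.Ring_Divisibility"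
    "HOL-Library.Extended_Nat"
begin

locale local_ring = cring R for R (structure) and \<mm> +
  assumes maximal: "maximalideal \<mm> R"
    and unique_maximal: "maximalideal M R \<Longrightarrow> M = \<mm>"

primrec ideal_pow :: "('a, 'b) ring_scheme \<Rightarrow> 'a set \<Rightarrow> nat \<Rightarrow> 'a set" where
  "ideal_pow R J 0 = carrier R"
| "ideal_pow R J (Suc n) = ideal_prod R J (ideal_pow R J n)"

definition integral_over_ideal :: "('a, 'b) ring_scheme \<Rightarrow> 'a set \<Rightarrow> 'a \<Rightarrow> bool" where
  "integral_over_ideal R J x \<longleftrightarrow>
     (\<exists>n a. n \<ge> 1 \<and> (\<forall>i\<in>{1..n}. a i \<in> ideal_pow R J i) \<and>
        x [^]\<^bsub>R\<^esub> n \<oplus>\<^bsub>R\<^esub> (\<Oplus>\<^bsub>R\<^esub>i\<in>{1..n}. a i \<otimes>\<^bsub>R\<^esub> x [^]\<^bsub>R\<^esub> (n - i)) = \<zero>\<^bsub>R\<^esub>)"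

definition integral_closure :: "('a, 'b) ring_scheme \<Rightarrow> 'a set \<Rightarrow> 'a set" where
  "integral_closure R J = {x \<in> carrier R. integral_over_ideal R J x}"

text \<open>The infimum of a nonempty set of extended naturals is its least element, and the
  infimum of the empty set is \<open>\<infinity>\<close>.\<close>

definition integral_dimension :: "('a, 'b) ring_scheme \<Rightarrow> enat" where
  "integral_dimension R =
     Inf {enat k | k. \<forall>J n. ideal J R \<longrightarrow> n \<ge> k \<longrightarrow>
            ideal_pow R (integral_closure R J) n \<subseteq> ideal_pow R J (n - k)}"

text \<open>The inverse limit of the rings \<open>R / I^n\<close>, with pointwise operations. The elements of
  \<open>R / I^n\<close> are cosets, and the canonical map \<open>R / I^(n+1) \<rightarrow> R / I^n\<close> sends a coset
  of \<open>I^(n+1)\<close> to the unique coset of \<open>I^n\<close> that includes it; hence compatibility of a family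
  \<open>f\<close> of cosets is the inclusion \<open>f (Suc n) \<subseteq> f n\<close>.\<close>

definition adic_completion :: "('a, 'b) ring_scheme \<Rightarrow> 'a set \<Rightarrow> (nat \<Rightarrow> 'a set) ring" where
  "adic_completion R I =
     \<lparr>carrier = {f. \<forall>n. f n \<in> carrier (R Quot ideal_pow R I n) \<and> f (Suc n) \<subseteq> f n},
      monoid.mult = (\<lambda>f g n. f n \<otimes>\<^bsub>R Quot ideal_pow R I n\<^esub> g n),
      one = (\<lambda>n. \<one>\<^bsub>R Quot ideal_pow R I n\<^esub>),
      zero = (\<lambda>n. \<zero>\<^bsub>R Quot ideal_pow R I n\<^esub>),
      add = (\<lambda>f g n. f n \<oplus>\<^bsub>R Quot ideal_pow R I n\<^esub> g n)\<rparr>"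

end

theory Submission
  imports Defs
begin

text \<open>
  Write \<open>S\<close> for the completion, \<open>I\<close> for the maximal ideal of \<open>R\<close>, and \<open>K t = I^t\<close>. An element \<open>f\<close> of \<open>S\<close>
  is a sequence of cosets, so \<open>r \<in> f t\<close> says that \<open>r\<close> represents \<open>f\<close> modulo the kernel of
  \<open>S \<rightarrow> R / I^t\<close>. Representatives of elements can be added, multiplied, and carried along products of
  ideals (\<open>rep_ideal_pow\<close>, \<open>lift_ideal_pow\<close>). Hence every inclusion between powers of ideals passes from one
  ring to the other up to an error in \<open>I^t\<close>, for every \<open>t\<close>, and the two inequalities say that
  such errors can be removed on either side. They are proved by showing that each bound \<open>k\<close> that is valid
  in one of the rings is valid in the other.

  From \<open>S\<close> to \<open>R\<close>: an ideal \<open>J\<close> of \<open>R\<close> is replaced by the ideal of all \<open>f\<close> in \<open>S\<close> that are represented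
  in \<open>J\<close> at every level. An element of \<open>R\<close> whose image lies in a power of this ideal lies in
  \<open>J^(n-k) + I^t\<close> for all \<open>t\<close>, hence in \<open>J^(n-k)\<close> by the Krull intersection theorem.

  From \<open>R\<close> to \<open>S\<close>: an ideal \<open>J\<close> of \<open>S\<close> is replaced, for each \<open>t\<close>, by the ideal \<open>J\<^sub>t\<close> of \<open>R\<close> of
  all elements that represent members of \<open>J\<close> at level \<open>t\<close>. It contains \<open>I^t\<close>, so its powers absorb errors of high
  order, and an element integral over \<open>J\<close> is represented at level \<open>t\<close> by an element integral over \<open>J\<^sub>t\<close>
  (\<open>integral_closure_rep\<close>). The bound in \<open>R\<close> then puts each element of the \<open>n\<close>-th power of the integral
  closure of \<open>J\<close> into the closure of \<open>J^(n-k)\<close> in the adic topology of \<open>S\<close>.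
  Only finitely many elements of \<open>J\<close> are involved in any one such membership, so \<open>J\<close> may be taken finitely
  generated; and finitely generated ideals of \<open>S\<close> are closed (\<open>closed_Idl_finite\<close>). The latter is a
  Mittag-Leffler argument: ideals of \<open>R\<close> that contain a fixed power of the maximal ideal
  satisfy the descending chain condition (\<open>descending_chain_stabilizes\<close>), so the coefficients of approximate solutions
  can be chosen to converge.
\<close>

section \<open>Products and powers of ideals\<close>

lemma (in cring) idealI_cring:
  assumes "I \<subseteq> carrier R" "\<zero> \<in> I"
    and "\<And>a b. a \<in> I \<Longrightarrow> b \<in> I \<Longrightarrow> a \<oplus> b \<in> I"
    and mult: "\<And>r a. r \<in> carrier R \<Longrightarrow> a \<in> I \<Longrightarrow> r \<otimes> a \<in> I"
  shows "ideal I R"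
proof (rule idealI[OF ring_axioms])
  have "\<ominus> a \<in> I" if "a \<in> I" for a
    using mult[OF a_inv_closed[OF one_closed] that] that assms(1) by (auto simp: l_minus)
  then show "subgroup I (add_monoid R)"
    using assms by (auto intro!: subgroup.intro simp: a_inv_def)
  show "a \<otimes> x \<in> I" if "a \<in> I" "x \<in> carrier R" for a x
    using mult[OF that(2,1)] m_comm[of a x] that assms(1) by auto
qed (use assms in auto)

lemma (in cring) mem_add_cgenideal_iff:
  "x \<in> Q <+>\<^bsub>R\<^esub> PIdl a \<longleftrightarrow> (\<exists>q\<in>Q. \<exists>c\<in>carrier R. x = q \<oplus> c \<otimes> a)"
  unfolding set_add_def' cgenideal_def by blast

lemma (in cring) add_cgenideal:
  assumes "ideal Q R" "a \<in> carrier R"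
  shows "ideal (Q <+>\<^bsub>R\<^esub> PIdl a) R" "Q \<subseteq> Q <+>\<^bsub>R\<^esub> PIdl a" "a \<in> Q <+>\<^bsub>R\<^esub> PIdl a"
proof -
  interpret Q: ideal Q R by fact
  show "ideal (Q <+>\<^bsub>R\<^esub> PIdl a) R"
    by (intro add_ideals cgenideal_ideal assms)
  show "Q \<subseteq> Q <+>\<^bsub>R\<^esub> PIdl a"
  proof
    fix q assume "q \<in> Q"
    then show "q \<in> Q <+>\<^bsub>R\<^esub> PIdl a"
      unfolding mem_add_cgenideal_iff using assms
      by (intro bexI[of _ q] bexI[of _ \<zero>]) (auto simp: Q.Icarr)
  qed
  show "a \<in> Q <+>\<^bsub>R\<^esub> PIdl a"
    unfolding mem_add_cgenideal_iff using assms
    by (intro bexI[of _ \<zero>] bexI[of _ \<one>]) auto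
qed

lemma (in cring) Idl_insert:
  assumes "B \<subseteq> carrier R" "b \<in> carrier R"
  shows "Idl (insert b B) = Idl B <+>\<^bsub>R\<^esub> PIdl b"
proof
  note idl = genideal_ideal[OF assms(1)]
  show "Idl (insert b B) \<subseteq> Idl B <+>\<^bsub>R\<^esub> PIdl b"
    using add_cgenideal[OF idl assms(2)] genideal_self[OF assms(1)]
    by (intro genideal_minimal) auto
  have sub: "insert b B \<subseteq> carrier R" using assms by auto
  interpret I: ideal "Idl (insert b B)" R by (rule genideal_ideal[OF sub])
  have "Idl B \<subseteq> Idl (insert b B)" "b \<in> Idl (insert b B)"
    using subset_Idl_subset[OF sub] genideal_self[OF sub] by auto
  then show "Idl B <+>\<^bsub>R\<^esub> PIdl b \<subseteq> Idl (insert b B)"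
    by (auto simp: mem_add_cgenideal_iff intro!: I.a_closed I.I_l_closed)
qed

lemma ideal_prod_mono:
  assumes "A \<subseteq> A'" "B \<subseteq> B'"
  shows "ideal_prod R A B \<subseteq> ideal_prod R A' B'"
proof
  fix x assume "x \<in> ideal_prod R A B"
  then show "x \<in> ideal_prod R A' B'"
    by induct (use assms in \<open>auto intro: ideal_prod.intros\<close>)
qed

lemma (in ring) ideal_prod_subset:
  assumes "ideal Q R" "\<And>a b. a \<in> A \<Longrightarrow> b \<in> B \<Longrightarrow> a \<otimes> b \<in> Q"
  shows "ideal_prod R A B \<subseteq> Q"
proof
  interpret Q: ideal Q R by fact
  fix x assume "x \<in> ideal_prod R A B"
  then show "x \<in> Q"
    by induct (use assms in \<open>auto\<close>)
qed

text \<open>The inclusion from left to right uses colon ideals: for fixed \<open>Y\<close> the elements that \<open>Y\<close> multiplies into a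
  given ideal form an ideal, so membership extends from generators to the generated ideals, one factor at a time.\<close>

lemma (in cring) ideal_prod_Idl:
  assumes "A \<subseteq> carrier R" "B \<subseteq> carrier R"
  shows "ideal_prod R (Idl A) (Idl B) = Idl {a \<otimes> b | a b. a \<in> A \<and> b \<in> B}" (is "_ = Idl ?C")
proof
  have C: "?C \<subseteq> carrier R" using assms by auto
  interpret C: ideal "Idl ?C" R by (rule genideal_ideal[OF C])
  have colon: "ideal {x \<in> carrier R. \<forall>y\<in>Y. y \<otimes> x \<in> Idl ?C} R" if Y: "Y \<subseteq> carrier R" for Y
  proof (rule idealI_cring)
    fix r x assume r: "r \<in> carrier R" and x: "x \<in> {x \<in> carrier R. \<forall>y\<in>Y. y \<otimes> x \<in> Idl ?C}"
    have "y \<otimes> (r \<otimes> x) \<in> Idl ?C" if "y \<in> Y" for y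
    proof -
      have "y \<otimes> (r \<otimes> x) = r \<otimes> (y \<otimes> x)" using that Y x r by (intro m_lcomm) auto
      then show ?thesis using x that r C.I_l_closed by simp
    qed
    then show "r \<otimes> x \<in> {x \<in> carrier R. \<forall>y\<in>Y. y \<otimes> x \<in> Idl ?C}" using r x by simp
  qed (use Y in \<open>auto simp: r_distr subset_iff\<close>)
  have "A \<subseteq> {x \<in> carrier R. \<forall>y\<in>B. y \<otimes> x \<in> Idl ?C}"
  proof
    fix x assume x: "x \<in> A"
    have "y \<otimes> x \<in> Idl ?C" if "y \<in> B" for y
    proof -
      have "x \<otimes> y \<in> Idl ?C" using genideal_self[OF C] x that by blast
      moreover have "x \<in> carrier R" "y \<in> carrier R" using x that assms by blast+
      ultimately show ?thesis by (simp add: m_comm[of y x])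
    qed
    then show "x \<in> {x \<in> carrier R. \<forall>y\<in>B. y \<otimes> x \<in> Idl ?C}" using assms x by blast
  qed
  then have A: "Idl A \<subseteq> {x \<in> carrier R. \<forall>y\<in>B. y \<otimes> x \<in> Idl ?C}"
    by (rule genideal_minimal[OF colon[OF assms(2)]])
  have "B \<subseteq> {x \<in> carrier R. \<forall>y\<in>Idl A. y \<otimes> x \<in> Idl ?C}"
  proof
    fix x assume x: "x \<in> B"
    have "y \<otimes> x \<in> Idl ?C" if "y \<in> Idl A" for y
    proof -
      have "y \<in> carrier R" "x \<otimes> y \<in> Idl ?C" using A x that by blast+
      moreover have "x \<in> carrier R" using x assms by blast
      ultimately show ?thesis by (simp add: m_comm[of y x])
    qed
    then show "x \<in> {x \<in> carrier R. \<forall>y\<in>Idl A. y \<otimes> x \<in> Idl ?C}" using assms x by blast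
  qed
  moreover have "Idl A \<subseteq> carrier R" using A by blast
  ultimately have "Idl B \<subseteq> {x \<in> carrier R. \<forall>y\<in>Idl A. y \<otimes> x \<in> Idl ?C}"
    using genideal_minimal[OF colon] by simp
  then show "ideal_prod R (Idl A) (Idl B) \<subseteq> Idl ?C"
    by (intro ideal_prod_subset[OF C.is_ideal]) auto
  show "Idl ?C \<subseteq> ideal_prod R (Idl A) (Idl B)"
  proof (rule genideal_minimal)
    show "ideal (ideal_prod R (Idl A) (Idl B)) R"
      by (intro ideal_prod_is_ideal genideal_ideal assms)
    show "?C \<subseteq> ideal_prod R (Idl A) (Idl B)"
      using genideal_self[OF assms(1)] genideal_self[OF assms(2)] by (blast intro: ideal_prod.prod)
  qed
qed

lemma (in ring) ideal_pow_is_ideal: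
  assumes "ideal J R"
  shows "ideal (ideal_pow R J n) R"
  by (induct n) (simp_all add: oneideal ideal_prod_is_ideal assms)

lemma ideal_pow_mono: "A \<subseteq> B \<Longrightarrow> ideal_pow R A n \<subseteq> ideal_pow R B n"
  by (induct n) (simp_all add: ideal_prod_mono)

lemma (in cring) ideal_pow_subset_carrier:
  assumes "A \<subseteq> carrier R"
  shows "ideal_pow R A n \<subseteq> carrier R"
proof (induct n)
  case (Suc n)
  then have "ideal_prod R A (ideal_pow R A n) \<subseteq> carrier R"
    using assms by (intro ideal_prod_subset oneideal) auto
  then show ?case by simp
qed simp

lemma (in cring) ideal_pow_add:
  assumes "ideal J R"
  shows "ideal_pow R J (a + b) = ideal_prod R (ideal_pow R J a) (ideal_pow R J b)"
proof (induct a)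
  case 0
  show ?case
    using ideal_prod_one[OF ideal_pow_is_ideal[OF assms]]
      ideal_prod_commute[OF oneideal ideal_pow_is_ideal[OF assms]] by simp
next
  case (Suc a)
  then show ?case
    using ideal_prod_assoc ideal_pow_is_ideal[OF assms] assms by simp
qed

lemma (in cring) ideal_pow_1: "ideal J R \<Longrightarrow> ideal_pow R J (Suc 0) = J"
  by (simp add: ideal_prod_one)

lemma (in cring) ideal_pow_antimono:
  assumes "ideal J R" "a \<le> b"
  shows "ideal_pow R J b \<subseteq> ideal_pow R J a"
  using ideal_pow_add[OF assms(1), of a "b - a"] assms(2)
    ideal_prod_inter[OF ideal_pow_is_ideal[OF assms(1)] ideal_pow_is_ideal[OF assms(1)], of a "b - a"]
  by auto

lemma (in cring) ideal_pow_ideal_pow: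
  assumes "ideal J R"
  shows "ideal_pow R (ideal_pow R J a) b = ideal_pow R J (a * b)"
  by (induct b) (auto simp: ideal_pow_add[OF assms])

text \<open>Expanding a product of \<open>n\<close> factors \<open>a + b\<close>, every term except the product of all the \<open>a\<close> lies in \<open>B\<close>.\<close>

lemma (in cring) ideal_pow_sum_subset:
  assumes "ideal A R" "ideal B R" "ideal Q R" "ideal_pow R A n \<subseteq> Q"
  shows "ideal_pow R (A <+>\<^bsub>R\<^esub> B) n \<subseteq> Q <+>\<^bsub>R\<^esub> B"
proof -
  interpret B: ideal B R by fact
  interpret A: ideal A R by fact
  have "ideal_pow R (A <+>\<^bsub>R\<^esub> B) n \<subseteq> ideal_pow R A n <+>\<^bsub>R\<^esub> B"
  proof (induct n)
    case 0
    show ?case by (auto simp: set_add_def' intro!: bexI[of _ \<zero>])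
  next
    case (Suc n)
    interpret P: ideal "ideal_pow R A n" R by (rule ideal_pow_is_ideal[OF assms(1)])
    interpret P': ideal "ideal_pow R A (Suc n)" R by (rule ideal_pow_is_ideal[OF assms(1)])
    have "x \<otimes> y \<in> ideal_pow R A (Suc n) <+>\<^bsub>R\<^esub> B"
      if "x \<in> A <+>\<^bsub>R\<^esub> B" "y \<in> ideal_pow R (A <+>\<^bsub>R\<^esub> B) n" for x y
    proof -
      obtain a b where x: "a \<in> A" "b \<in> B" "x = a \<oplus> b"
        using \<open>x \<in> A <+>\<^bsub>R\<^esub> B\<close> by (auto simp: set_add_def')
      obtain p b' where y: "p \<in> ideal_pow R A n" "b' \<in> B" "y = p \<oplus> b'"
        using \<open>y \<in> _\<close> Suc by (auto simp: set_add_def')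
      have "x \<otimes> y = a \<otimes> p \<oplus> (a \<otimes> b' \<oplus> b \<otimes> (p \<oplus> b'))"
        using x y A.Icarr B.Icarr P.Icarr by (simp, algebra)
      moreover have "a \<otimes> p \<in> ideal_pow R A (Suc n)" using x y by (auto intro: ideal_prod.prod)
      moreover have "a \<otimes> b' \<oplus> b \<otimes> (p \<oplus> b') \<in> B"
        using x y A.Icarr B.Icarr P.Icarr
        by (intro B.a_closed B.I_l_closed[of b' a] B.I_r_closed[of b]) auto
      ultimately show ?thesis unfolding set_add_def' by blast
    qed
    then show ?case
      unfolding ideal_pow.simps(2)[of R "A <+>\<^bsub>R\<^esub> B"]
      by (intro ideal_prod_subset add_ideals P'.is_ideal B.is_ideal) auto
  qed
  also have "\<dots> \<subseteq> Q <+>\<^bsub>R\<^esub> B" using assms(4) by (auto simp: set_add_def')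
  finally show ?thesis .
qed

lemma (in cring) ideal_pow_cgenideal:
  assumes "a \<in> carrier R"
  shows "ideal_pow R (PIdl a) n \<subseteq> PIdl (a [^] n)"
proof (induct n)
  case 0
  have "x \<in> PIdl \<one>" if "x \<in> carrier R" for x
    unfolding cgenideal_def using that by (intro CollectI exI[of _ x]) simp
  then show ?case by auto
next
  case (Suc n)
  have "x \<otimes> y \<in> PIdl (a [^] Suc n)" if "x \<in> PIdl a" "y \<in> PIdl (a [^] n)" for x y
  proof -
    from that obtain u v where uv: "u \<in> carrier R" "v \<in> carrier R" "x = u \<otimes> a" "y = v \<otimes> a [^] n"
      by (auto simp: cgenideal_def)
    then have "x \<otimes> y = (u \<otimes> v) \<otimes> a [^] Suc n"
      using assms nat_pow_closed[OF assms, of n] unfolding nat_pow_Suc uv by algebra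
    then show ?thesis using uv unfolding cgenideal_def by blast
  qed
  then show ?case
    using Suc assms by (simp only: ideal_pow.simps) (intro ideal_prod_subset cgenideal_ideal, auto)
qed

section \<open>Noetherian local rings\<close>

text \<open>Noetherian induction in the form of the maximum condition.\<close>

lemma (in noetherian_ring) ex_maximal_ideal:
  assumes "P I0" "\<And>I. P I \<Longrightarrow> ideal I R"
  shows "\<exists>M. P M \<and> (\<forall>I. P I \<longrightarrow> M \<subseteq> I \<longrightarrow> I = M)"
proof -
  have "\<exists>M\<in>Collect P. \<forall>X\<in>Collect P. M \<subseteq> X \<longrightarrow> X = M"
  proof (rule subset_Zorn)
    fix C assume C: "subset.chain (Collect P) C"
    show "\<exists>U\<in>Collect P. \<forall>X\<in>C. X \<subseteq> U"
    proof (cases "C = {}")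
      case False
      have "subset.chain {I. ideal I R} C"
        using C assms(2) unfolding pred_on.chain_def by auto
      then have "\<Union>C \<in> C" using False by (rule ideal_chain_is_trivial[rotated])
      moreover have "C \<subseteq> Collect P" using C by (simp add: pred_on.chain_def)
      ultimately show ?thesis by (metis Union_upper subsetD)
    qed (use assms(1) in auto)
  qed
  then show ?thesis by simp
qed

locale noetherian_local_ring = noetherian_ring R + local_ring R \<mm> for R (structure) and \<mm>
begin

sublocale \<mm>: maximalideal \<mm> R by (rule maximal)

lemma unit_outside_max:
  assumes "r \<in> carrier R" "r \<notin> \<mm>"
  obtains s where "s \<in> carrier R" "s \<otimes> r = \<one>"
proof -
  have "\<one> \<in> PIdl r"
  proof (rule ccontr)
    assume "\<one> \<notin> PIdl r"
    then have "\<exists>M. (ideal M R \<and> \<one> \<notin> M \<and> r \<in> M) \<and>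
        (\<forall>I. ideal I R \<and> \<one> \<notin> I \<and> r \<in> I \<longrightarrow> M \<subseteq> I \<longrightarrow> I = M)"
      using cgenideal_ideal cgenideal_self assms by (intro ex_maximal_ideal[of _ "PIdl r"]) simp_all
    then obtain M where M: "ideal M R" "\<one> \<notin> M" "r \<in> M"
      and max: "\<And>I. ideal I R \<Longrightarrow> \<one> \<notin> I \<Longrightarrow> r \<in> I \<Longrightarrow> M \<subseteq> I \<Longrightarrow> I = M"
      by (elim exE conjE) blast
    have "maximalideal M R"
    proof (rule maximalidealI)
      show "J = M \<or> J = carrier R" if "ideal J R" "M \<subseteq> J" "J \<subseteq> carrier R" for J
        using max[OF that(1) _ _ that(2)] that M ideal.one_imp_carrier[OF that(1)] by blast
      show "ideal M R" by fact
      show "carrier R \<noteq> M" using M(2) one_closed by blast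
    qed
    then show False using unique_maximal M assms by blast
  qed
  then obtain s where "s \<in> carrier R" "\<one> = s \<otimes> r" unfolding cgenideal_def by blast
  then show thesis using that by simp
qed

text \<open>The instance of Nakayama's lemma for a single element: \<open>1 - a\<close> is a unit.\<close>

lemma one_minus_max_cancel:
  assumes "ideal Q R" "a \<in> \<mm>" "b \<in> carrier R" "b \<ominus> a \<otimes> b \<in> Q"
  shows "b \<in> Q"
proof -
  interpret Q: ideal Q R by fact
  have "\<one> \<ominus> a \<notin> \<mm>"
  proof
    assume "\<one> \<ominus> a \<in> \<mm>"
    then have "(\<one> \<ominus> a) \<oplus> a \<in> \<mm>" using assms(2) by (rule \<mm>.a_closed)
    moreover have "(\<one> \<ominus> a) \<oplus> a = \<one>" using \<mm>.Icarr[OF assms(2)] by algebra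
    ultimately show False using \<mm>.one_imp_carrier \<mm>.I_notcarr by simp
  qed
  then obtain s where s: "s \<in> carrier R" "s \<otimes> (\<one> \<ominus> a) = \<one>"
    using unit_outside_max[of "\<one> \<ominus> a"] \<mm>.Icarr[OF assms(2)] by blast
  have "b = (s \<otimes> (\<one> \<ominus> a)) \<otimes> b" using s assms by simp
  also have "\<dots> = s \<otimes> (b \<ominus> a \<otimes> b)" using s(1) assms(3) \<mm>.Icarr[OF assms(2)] by algebra
  finally show ?thesis using Q.I_l_closed[OF assms(4) s(1)] by simp
qed

text \<open>An ideal maximal among those below \<open>\<mm>\<close> with a power in \<open>Q\<close> must be \<open>\<mm>\<close>: if \<open>M\<close> has a
  power in \<open>Q\<close> and so does \<open>a\<close>, then expanding twice shows that \<open>M + (a)\<close> has one as well.\<close>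

lemma max_pow_subset:
  assumes "ideal Q R" "\<And>a. a \<in> \<mm> \<Longrightarrow> \<exists>n::nat. a [^] n \<in> Q"
  shows "\<exists>t. ideal_pow R \<mm> t \<subseteq> Q"
proof -
  interpret Q: ideal Q R by fact
  define P where "P = (\<lambda>I. ideal I R \<and> I \<subseteq> \<mm> \<and> (\<exists>t. ideal_pow R I t \<subseteq> Q))"
  have "P {\<zero>}"
    using ideal_pow_1[OF zeroideal] zeroideal unfolding P_def by (auto intro!: exI[of _ "Suc 0"])
  then obtain M where M: "P M" and max: "\<And>I. P I \<Longrightarrow> M \<subseteq> I \<Longrightarrow> I = M"
    using ex_maximal_ideal[of P "{\<zero>}"] unfolding P_def by blast
  then obtain s where s: "ideal_pow R M s \<subseteq> Q" and id: "ideal M R" and sub: "M \<subseteq> \<mm>"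
    unfolding P_def by auto
  interpret M: ideal M R by fact
  have "M = \<mm>"
  proof (rule ccontr)
    assume "M \<noteq> \<mm>"
    then obtain a where a: "a \<in> \<mm>" "a \<notin> M" using sub by auto
    have ac: "a \<in> carrier R" using a by auto
    obtain t :: nat where t: "a [^] t \<in> Q" using assms(2) a by auto
    note N = add_cgenideal[OF id ac]
    have N_eq: "PIdl a <+>\<^bsub>R\<^esub> M = M <+>\<^bsub>R\<^esub> PIdl a"
      by (rule set_add_comm) (use id ac cgenideal_ideal in \<open>auto dest: ideal.Icarr\<close>)
    have "ideal_pow R (PIdl a <+>\<^bsub>R\<^esub> M) t \<subseteq> Q <+>\<^bsub>R\<^esub> M"
      using ideal_pow_cgenideal[OF ac, of t] cgenideal_minimal[OF assms(1) t]
      by (intro ideal_pow_sum_subset cgenideal_ideal ac id assms) auto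
    also have "Q <+>\<^bsub>R\<^esub> M = M <+>\<^bsub>R\<^esub> Q" by (rule set_add_comm) auto
    finally have "ideal_pow R (ideal_pow R (M <+>\<^bsub>R\<^esub> PIdl a) t) s \<subseteq> ideal_pow R (M <+>\<^bsub>R\<^esub> Q) s"
      unfolding N_eq by (rule ideal_pow_mono)
    also have "\<dots> \<subseteq> Q <+>\<^bsub>R\<^esub> Q" by (intro ideal_pow_sum_subset assms id s)
    also have "\<dots> \<subseteq> Q" by (auto simp: set_add_def')
    finally have "ideal_pow R (M <+>\<^bsub>R\<^esub> PIdl a) (t * s) \<subseteq> Q" by (simp add: ideal_pow_ideal_pow[OF N(1)])
    moreover have "M <+>\<^bsub>R\<^esub> PIdl a \<subseteq> \<mm>"
      using sub a by (auto simp: mem_add_cgenideal_iff intro!: \<mm>.a_closed \<mm>.I_l_closed)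
    ultimately have "P (M <+>\<^bsub>R\<^esub> PIdl a)" using N unfolding P_def by auto
    from max[OF this N(2)] N(3) a show False by auto
  qed
  then show ?thesis using s by auto
qed

text \<open>If \<open>b\<close> lay outside \<open>Q\<close>, then by Nakayama it would lie outside \<open>Q + \<mm> b\<close>; let \<open>M\<close> be an ideal maximal among
  those that contain \<open>Q + \<mm> b\<close> but not \<open>b\<close>. For \<open>a\<close> in \<open>\<mm>\<close>, the colon ideals \<open>(M : a^n)\<close> become stationary,
  and this forces some \<open>a^n\<close> into \<open>M\<close>. Hence a whole power of \<open>\<mm>\<close> lies in \<open>M\<close>, and as \<open>b\<close> is
  approximated by elements of \<open>Q\<close> to that order, \<open>b\<close> lies in \<open>M\<close>, a contradiction.\<close>

lemma Krull_intersection: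
  assumes "ideal Q R" "b \<in> carrier R"
    and b: "\<And>t. \<exists>q\<in>Q. b \<ominus> q \<in> ideal_pow R \<mm> t"
  shows "b \<in> Q"
proof (rule ccontr)
  assume "b \<notin> Q"
  interpret Q: ideal Q R by fact
  define P where "P = (\<lambda>I. ideal I R \<and> Q \<subseteq> I \<and> (\<forall>a\<in>\<mm>. a \<otimes> b \<in> I) \<and> b \<notin> I)"
  define I0 where "I0 = {q \<oplus> a \<otimes> b | q a. q \<in> Q \<and> a \<in> \<mm>}"
  have I0I: "q \<oplus> a \<otimes> b \<in> I0" if "q \<in> Q" "a \<in> \<mm>" for q a
    unfolding I0_def using that by blast
  have "ideal I0 R"
  proof (rule idealI_cring)
    show "I0 \<subseteq> carrier R" using assms(2) unfolding I0_def by auto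
    show "\<zero> \<in> I0" using I0I[of \<zero> \<zero>] assms(2) by simp
    fix x y assume "x \<in> I0" "y \<in> I0"
    then obtain q a q' a' where *: "q \<in> Q" "a \<in> \<mm>" "x = q \<oplus> a \<otimes> b" "q' \<in> Q" "a' \<in> \<mm>" "y = q' \<oplus> a' \<otimes> b"
      unfolding I0_def by auto
    then have "x \<oplus> y = (q \<oplus> q') \<oplus> (a \<oplus> a') \<otimes> b"
      using assms(2) Q.Icarr \<mm>.Icarr by (simp, algebra)
    moreover have "q \<oplus> q' \<in> Q" "a \<oplus> a' \<in> \<mm>" using * by auto
    ultimately show "x \<oplus> y \<in> I0" using I0I by simp
  next
    fix r x assume r: "r \<in> carrier R" "x \<in> I0"
    then obtain q a where *: "q \<in> Q" "a \<in> \<mm>" "x = q \<oplus> a \<otimes> b"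
      unfolding I0_def by auto
    then have "r \<otimes> x = r \<otimes> q \<oplus> (r \<otimes> a) \<otimes> b"
      using assms(2) Q.Icarr \<mm>.Icarr r by (simp, algebra)
    moreover have "r \<otimes> q \<in> Q" "r \<otimes> a \<in> \<mm>" using * r by (auto intro: Q.I_l_closed \<mm>.I_l_closed)
    ultimately show "r \<otimes> x \<in> I0" using I0I by simp
  qed
  moreover have "Q \<subseteq> I0"
  proof
    fix q assume "q \<in> Q"
    then show "q \<in> I0" using I0I[of q \<zero>] assms(2) Q.Icarr by simp
  qed
  moreover have "\<forall>a\<in>\<mm>. a \<otimes> b \<in> I0"
  proof
    fix a assume "a \<in> \<mm>"
    then show "a \<otimes> b \<in> I0" using I0I[of \<zero> a] assms(2) \<mm>.Icarr by simp
  qed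
  moreover have "b \<notin> I0"
  proof
    assume "b \<in> I0"
    then obtain q a where *: "q \<in> Q" "a \<in> \<mm>" "b = q \<oplus> a \<otimes> b"
      unfolding I0_def by auto
    then have "b \<ominus> a \<otimes> b = q"
      using assms(2) Q.Icarr \<mm>.Icarr by (metis a_minus_def add.inv_solve_right' m_closed)
    then show False using one_minus_max_cancel[OF assms(1) *(2) assms(2)] * \<open>b \<notin> Q\<close> by simp
  qed
  ultimately have "P I0" unfolding P_def by simp
  then obtain M where "P M" and max: "\<And>I. P I \<Longrightarrow> M \<subseteq> I \<Longrightarrow> I = M"
    using ex_maximal_ideal[of P I0] unfolding P_def by blast
  then have M: "ideal M R" "Q \<subseteq> M" "\<And>a. a \<in> \<mm> \<Longrightarrow> a \<otimes> b \<in> M" "b \<notin> M"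
    unfolding P_def by auto
  interpret M: ideal M R by fact
  have "\<exists>n::nat. a [^] n \<in> M" if a: "a \<in> \<mm>" for a
  proof -
    have ac[simp]: "a \<in> carrier R" using a by auto
    \<comment> \<open>The colon ideals \<open>(M : a^n)\<close>.\<close>
    define L where "L = (\<lambda>n::nat. {x \<in> carrier R. a [^] n \<otimes> x \<in> M})"
    have L: "ideal (L n) R" for n
    proof (rule idealI_cring)
      fix r x assume r: "r \<in> carrier R" "x \<in> L n"
      then have "a [^] n \<otimes> (r \<otimes> x) = r \<otimes> (a [^] n \<otimes> x)" by (intro m_lcomm) (auto simp: L_def)
      then show "r \<otimes> x \<in> L n" using r M.I_l_closed unfolding L_def by simp
    qed (auto simp: L_def r_distr)
    have "L n \<subseteq> L (Suc n)" for n
    proof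
      fix x assume "x \<in> L n"
      then have x: "x \<in> carrier R" "a [^] n \<otimes> x \<in> M" unfolding L_def by auto
      have "a [^] Suc n \<otimes> x = a \<otimes> (a [^] n \<otimes> x)"
        using x(1) ac nat_pow_closed[OF ac, of n] unfolding nat_pow_Suc by algebra
      then show "x \<in> L (Suc n)" using M.I_l_closed[OF x(2) ac] x(1) unfolding L_def by simp
    qed
    then have mono: "L n \<subseteq> L k" if "n \<le> k" for n k
      using that by (rule lift_Suc_mono_le)
    have "\<exists>N. (\<exists>n. N = L n) \<and> (\<forall>I. (\<exists>n. I = L n) \<longrightarrow> N \<subseteq> I \<longrightarrow> I = N)"
    proof (rule ex_maximal_ideal[of "\<lambda>I. \<exists>n. I = L n" "L 0"])
      show "\<exists>n. L 0 = L n" by (rule exI[of _ 0]) simp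
      show "ideal I R" if "\<exists>n. I = L n" for I using that L by (elim exE) simp
    qed
    then obtain N n where n: "N = L n" and N: "\<forall>I. (\<exists>n. I = L n) \<longrightarrow> N \<subseteq> I \<longrightarrow> I = N"
      by (elim exE conjE)
    have stable: "L (Suc n) = L n" using N[rule_format, OF exI, of "L (Suc n)" "Suc n"] mono[of n "Suc n"] n by simp
    have "a [^] n \<in> M"
    proof (rule ccontr)
      assume "a [^] n \<notin> M"
      note A = add_cgenideal[OF M(1) nat_pow_closed[OF ac, of n]]
      have "b \<in> M <+>\<^bsub>R\<^esub> PIdl (a [^] n)"
      proof (rule ccontr)
        assume "b \<notin> M <+>\<^bsub>R\<^esub> PIdl (a [^] n)"
        moreover have "\<forall>c\<in>\<mm>. c \<otimes> b \<in> M <+>\<^bsub>R\<^esub> PIdl (a [^] n)" by (intro ballI subsetD[OF A(2)] M(3))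
        ultimately have "P (M <+>\<^bsub>R\<^esub> PIdl (a [^] n))" unfolding P_def using A M(2) by simp
        from max[OF this A(2)] A(3) \<open>a [^] n \<notin> M\<close> show False by simp
      qed
      then obtain m c where m: "m \<in> M" "c \<in> carrier R" "b = m \<oplus> c \<otimes> a [^] n"
        unfolding mem_add_cgenideal_iff by auto
      have "a [^] Suc n \<otimes> c = a \<otimes> b \<ominus> a \<otimes> m"
        using m(2) M.Icarr[OF m(1)] nat_pow_closed[OF ac, of n] ac unfolding nat_pow_Suc m(3)
        by algebra
      also have "\<dots> \<in> M" using M(3)[OF a] M.I_l_closed[OF m(1) ac] by (simp add: a_minus_def)
      finally have "c \<in> L (Suc n)" using m unfolding L_def by auto
      then have "a [^] n \<otimes> c \<in> M" unfolding stable by (simp add: L_def)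
      then have "b \<in> M" using m by (simp add: m_comm[of c])
      then show False using M by auto
    qed
    then show ?thesis ..
  qed
  then obtain t where "ideal_pow R \<mm> t \<subseteq> M" using max_pow_subset[OF M(1)] by auto
  then obtain q where q: "q \<in> M" "b \<ominus> q \<in> M" using b[of t] M(2) by blast
  then have "(b \<ominus> q) \<oplus> q \<in> M" by auto
  moreover have "(b \<ominus> q) \<oplus> q = b" using assms(2) M.Icarr[OF q(1)] by algebra
  ultimately show False using M by auto
qed

text \<open>The quotient \<open>R / Q\<close> has nonzero socle: take \<open>y\<close> in the last power of \<open>\<mm>\<close> that is not contained in \<open>Q\<close>.\<close>

lemma ex_socle_element:
  assumes "ideal Q R" "Q \<noteq> carrier R" "ideal_pow R \<mm> j \<subseteq> Q"
  obtains y where "y \<in> carrier R" "y \<notin> Q" "\<And>a. a \<in> \<mm> \<Longrightarrow> a \<otimes> y \<in> Q"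
proof -
  interpret Q: ideal Q R by fact
  define i where "i = (LEAST i. ideal_pow R \<mm> i \<subseteq> Q)"
  have i: "ideal_pow R \<mm> i \<subseteq> Q" unfolding i_def by (rule LeastI, fact)
  have "i \<noteq> 0" using i assms(2) Q.a_subset by (cases i) auto
  then obtain i' where i': "i = Suc i'" by (cases i) auto
  then have "\<not> ideal_pow R \<mm> i' \<subseteq> Q"
    using not_less_Least[of i' "\<lambda>i. ideal_pow R \<mm> i \<subseteq> Q"] unfolding i_def by auto
  then obtain y where y: "y \<in> ideal_pow R \<mm> i'" "y \<notin> Q" by auto
  show thesis
  proof (rule that)
    show "y \<in> carrier R" using y ideal.Icarr[OF ideal_pow_is_ideal[OF \<mm>.is_ideal]] by auto
    show "y \<notin> Q" by fact
    show "a \<otimes> y \<in> Q" if "a \<in> \<mm>" for a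
      using i y that unfolding i' by (auto intro!: subsetD[OF i[unfolded i']] ideal_prod.prod)
  qed
qed

text \<open>Noetherian induction on the lower bound \<open>Q\<close> of the chain replaces a count of lengths. If \<open>Q\<close> is maximal among the
  lower bounds for which the claim fails and \<open>y\<close> is a socle element of \<open>R / Q\<close>, then the chain \<open>D t + (y)\<close>
  stabilizes. Since \<open>(Q + (y)) / Q\<close> is simple, \<open>D t\<close> either always contains \<open>y\<close>, or eventually meets
  \<open>Q + (y)\<close> only in \<open>Q\<close>. In the first case \<open>D t = D t + (y)\<close>; in the second the modular law shows that
  \<open>D t\<close> itself stabilizes.\<close>

lemma descending_chain_stabilizes:
  assumes D: "\<And>t. ideal (D t) R" "\<And>t. D (Suc t) \<subseteq> D t" and j: "\<And>t. ideal_pow R \<mm> j \<subseteq> D t"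
  shows "\<exists>T. \<forall>t\<ge>T. D t = D T"
proof -
  define good where "good = (\<lambda>Q. \<forall>D :: nat \<Rightarrow> 'a set. (\<forall>t. ideal (D t) R) \<longrightarrow> (\<forall>t. D (Suc t) \<subseteq> D t)
     \<longrightarrow> (\<forall>t. Q \<subseteq> D t) \<longrightarrow> (\<exists>T. \<forall>t\<ge>T. D t = D T))"
  have "good (ideal_pow R \<mm> j)"
  proof (rule ccontr)
    assume "\<not> ?thesis"
    then have "\<exists>Q. (ideal Q R \<and> ideal_pow R \<mm> j \<subseteq> Q \<and> \<not> good Q) \<and>
        (\<forall>I. ideal I R \<and> ideal_pow R \<mm> j \<subseteq> I \<and> \<not> good I \<longrightarrow> Q \<subseteq> I \<longrightarrow> I = Q)"
      using ideal_pow_is_ideal[OF \<mm>.is_ideal]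
      by (intro ex_maximal_ideal[of _ "ideal_pow R \<mm> j"]) simp_all
    then obtain Q where Q: "ideal Q R" "ideal_pow R \<mm> j \<subseteq> Q" "\<not> good Q"
      and max: "\<And>I. ideal I R \<Longrightarrow> ideal_pow R \<mm> j \<subseteq> I \<Longrightarrow> \<not> good I \<Longrightarrow> Q \<subseteq> I \<Longrightarrow> I = Q"
      by (elim exE conjE) blast
    interpret Q: ideal Q R by fact
    from Q(3) obtain D where D: "\<And>t. ideal (D t) R" "\<And>t. D (Suc t) \<subseteq> D t" "\<And>t. Q \<subseteq> D t"
      and unstable: "\<not> (\<exists>T. \<forall>t\<ge>T. D t = D T)" unfolding good_def by blast
    have mono: "D t' \<subseteq> D t" if "t \<le> t'" for t t'
      using lift_Suc_antimono_le[of D, OF D(2) that] .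
    have "Q \<noteq> carrier R"
    proof
      assume "Q = carrier R"
      then have "D t = carrier R" for t
        using D(3)[of t] ideal.Icarr[OF D(1)] by blast
      then show False using unstable by auto
    qed
    then obtain y where y: "y \<in> carrier R" "y \<notin> Q" "\<And>a. a \<in> \<mm> \<Longrightarrow> a \<otimes> y \<in> Q"
      using ex_socle_element[OF Q(1) _ Q(2)] by blast
    note A = add_cgenideal[OF Q(1) y(1)]
    have "good (Q <+>\<^bsub>R\<^esub> PIdl y)" using max[OF A(1)] A y Q by blast
    moreover have D': "ideal (D t <+>\<^bsub>R\<^esub> PIdl y) R" "D t \<subseteq> D t <+>\<^bsub>R\<^esub> PIdl y" "y \<in> D t <+>\<^bsub>R\<^esub> PIdl y" for t
      using add_cgenideal[OF D(1) y(1)] by auto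
    moreover have "D (Suc t) <+>\<^bsub>R\<^esub> PIdl y \<subseteq> D t <+>\<^bsub>R\<^esub> PIdl y" for t
      using D(2)[of t] unfolding set_add_def' by auto
    moreover have "Q <+>\<^bsub>R\<^esub> PIdl y \<subseteq> D t <+>\<^bsub>R\<^esub> PIdl y" for t
      using D(3)[of t] unfolding set_add_def' by auto
    ultimately have "\<exists>T. \<forall>t\<ge>T. D t <+>\<^bsub>R\<^esub> PIdl y = D T <+>\<^bsub>R\<^esub> PIdl y"
      unfolding good_def by (auto dest!: spec[of _ "\<lambda>t. D t <+>\<^bsub>R\<^esub> PIdl y"])
    then obtain T where T: "\<And>t. t \<ge> T \<Longrightarrow> D t <+>\<^bsub>R\<^esub> PIdl y = D T <+>\<^bsub>R\<^esub> PIdl y" by auto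
    show False
    proof (cases "\<forall>t. y \<in> D t")
      case True
      have absorb: "D t <+>\<^bsub>R\<^esub> PIdl y = D t" for t
      proof
        interpret t: ideal "D t" R by (rule D)
        show "D t <+>\<^bsub>R\<^esub> PIdl y \<subseteq> D t"
        proof
          fix x assume "x \<in> D t <+>\<^bsub>R\<^esub> PIdl y"
          then obtain q c where "q \<in> D t" "c \<in> carrier R" "x = q \<oplus> c \<otimes> y"
            unfolding mem_add_cgenideal_iff by blast
          then show "x \<in> D t" using True t.I_l_closed by simp
        qed
      qed (rule D'(2))
      have "\<exists>T. \<forall>t\<ge>T. D t = D T" using T unfolding absorb by blast
      with unstable show False by (rule notE)
    next
      case False
      then obtain T' where T': "y \<notin> D T'" by auto
      define U where "U = max T T'"
      have "D t = D U" if "t \<ge> U" for t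
      proof
        show "D t \<subseteq> D U" using mono that by auto
        show "D U \<subseteq> D t"
        proof
          fix z assume z: "z \<in> D U"
          interpret U: ideal "D U" R by (rule D)
          interpret t: ideal "D t" R by (rule D)
          have "z \<in> D t <+>\<^bsub>R\<^esub> PIdl y"
            using T[of t] T[of U] that z D'(2)[of U] unfolding U_def by auto
          then obtain d r where dr: "d \<in> D t" "r \<in> carrier R" "z = d \<oplus> r \<otimes> y"
            unfolding mem_add_cgenideal_iff by auto
          have "r \<otimes> y = z \<ominus> d" using dr y(1) t.Icarr[OF dr(1)] unfolding dr(3) by algebra
          also have "\<dots> \<in> D U" using z dr mono[OF that] by (auto simp: a_minus_def)
          finally have ry: "r \<otimes> y \<in> D U" .
          have "r \<in> \<mm>"
          proof (rule ccontr)
            assume "r \<notin> \<mm>"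
            then obtain s where s: "s \<in> carrier R" "s \<otimes> r = \<one>" using unit_outside_max dr by blast
            have "y = s \<otimes> (r \<otimes> y)" using s dr(2) y(1) by (simp add: m_assoc[symmetric])
            then have "y \<in> D U" using U.I_l_closed[OF ry s(1)] by simp
            then show False using T' mono[of T' U] unfolding U_def by auto
          qed
          then have "r \<otimes> y \<in> D t" using y(3) D(3) by auto
          then show "z \<in> D t" using dr by auto
        qed
      qed
      then have "\<exists>T. \<forall>t\<ge>T. D t = D T" by blast
      with unstable show False by (rule notE)
    qed
  qed
  then have "(\<forall>t. ideal (D t) R) \<longrightarrow> (\<forall>t. D (Suc t) \<subseteq> D t) \<longrightarrow>
      (\<forall>t. ideal_pow R \<mm> j \<subseteq> D t) \<longrightarrow> (\<exists>T. \<forall>t\<ge>T. D t = D T)"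
    unfolding good_def by (rule spec)
  then show ?thesis using D j by blast
qed

end

section \<open>The completion as a ring\<close>

text \<open>Elements of the completion are handled through representatives: \<open>a \<in> f t\<close> says that \<open>a\<close> and \<open>f\<close> have the same
  image in \<open>R / I^t\<close>, because \<open>f t\<close> is itself the coset of \<open>I^t\<close> that is this image.\<close>

locale adic_ring = cring R + ideal I R for R (structure) and I
begin

abbreviation S where "S \<equiv> adic_completion R I"
abbreviation K where "K n \<equiv> ideal_pow R I n"

lemma K_ideal: "ideal (K t) R"
  by (rule ideal_pow_is_ideal) (rule is_ideal)

lemma K_zero: "\<zero> \<in> K t"
  by (rule additive_subgroup.zero_closed[OF ideal.axioms(1)[OF K_ideal]])

lemma quot_mult:
  assumes "a \<in> carrier R" "b \<in> carrier R"
  shows "(K t +> a) \<otimes>\<^bsub>R Quot K t\<^esub> (K t +> b) = K t +> (a \<otimes> b)"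
  using ideal.rcoset_mult_add[OF K_ideal assms] by (simp add: FactRing_def)

lemma quot_add:
  assumes "a \<in> carrier R" "b \<in> carrier R"
  shows "(K t +> a) \<oplus>\<^bsub>R Quot K t\<^esub> (K t +> b) = K t +> (a \<oplus> b)"
  using ideal.a_rcos_sum[OF K_ideal assms] by (simp add: FactRing_def)

lemma mem_coset_iff:
  assumes "a \<in> carrier R"
  shows "b \<in> K t +> a \<longleftrightarrow> b \<in> carrier R \<and> b \<ominus> a \<in> K t"
proof -
  interpret K: ideal "K t" R by (rule K_ideal)
  show ?thesis
    using K.a_rcos_module_minus[OF ring_axioms assms] K.a_elemrcos_carrier[OF assms] by blast
qed

lemma coset_self: "a \<in> carrier R \<Longrightarrow> a \<in> K t +> a"
  by (simp add: mem_coset_iff a_minus_def r_neg K_zero)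

lemma coset_eqI:
  assumes "a \<in> carrier R" "b \<in> K t +> a"
  shows "K t +> a = K t +> b"
proof -
  interpret K: ideal "K t" R by (rule K_ideal)
  show ?thesis by (rule K.a_repr_independence') fact+
qed

lemma completion_simps:
  "(f \<otimes>\<^bsub>S\<^esub> g) t = f t \<otimes>\<^bsub>R Quot K t\<^esub> g t"
  "(f \<oplus>\<^bsub>S\<^esub> g) t = f t \<oplus>\<^bsub>R Quot K t\<^esub> g t"
  "\<one>\<^bsub>S\<^esub> t = K t +> \<one>"
  "\<zero>\<^bsub>S\<^esub> t = K t"
  by (simp_all add: adic_completion_def FactRing_def)

lemma completion_level:
  assumes "f \<in> carrier S"
  shows "\<exists>a\<in>carrier R. f t = K t +> a"
  using assms unfolding adic_completion_def FactRing_def A_RCOSETS_def' by simp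

lemma completion_rep:
  assumes "f \<in> carrier S"
  shows "\<exists>a\<in>carrier R. a \<in> f t"
proof -
  obtain a where "a \<in> carrier R" "f t = K t +> a" using completion_level[OF assms] ..
  then show ?thesis using coset_self[of a t] by blast
qed

lemma completion_rep_carrier:
  assumes "f \<in> carrier S" "a \<in> f t"
  shows "a \<in> carrier R"
proof -
  obtain b where "b \<in> carrier R" "f t = K t +> b" using completion_level[OF assms(1)] ..
  then show ?thesis using assms(2) mem_coset_iff by simp
qed

lemma completion_eq_coset:
  assumes "f \<in> carrier S" "a \<in> f t"
  shows "f t = K t +> a"
proof -
  obtain b where "b \<in> carrier R" "f t = K t +> b" using completion_level[OF assms(1)] ..
  then show ?thesis using assms(2) coset_eqI[of b a t] by simp
qed

lemma completion_antimono:
  assumes "f \<in> carrier S" "s \<le> t"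
  shows "f t \<subseteq> f s"
proof (rule lift_Suc_antimono_le[of f])
  show "f (Suc n) \<subseteq> f n" for n using assms(1) by (simp add: adic_completion_def)
qed fact

lemma completion_eq_level:
  assumes "f \<in> carrier S" "g \<in> carrier S" "a \<in> f t" "a \<in> g t"
  shows "f t = g t"
  using completion_eq_coset[OF assms(1,3)] completion_eq_coset[OF assms(2,4)] by simp

lemma completion_rep_diff:
  assumes "f \<in> carrier S" "a \<in> f t" "b \<in> f t"
  shows "b \<ominus> a \<in> K t"
  using completion_eq_coset[OF assms(1,2)] completion_rep_carrier[OF assms(1,2)] assms(3)
  by (simp add: mem_coset_iff)

text \<open>Completeness: a Cauchy sequence in \<open>R\<close> defines an element of the completion.\<close>

lemma limit_in_completion:
  assumes "\<And>t. r t \<in> carrier R" "\<And>t. r (Suc t) \<ominus> r t \<in> K t"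
  shows "(\<lambda>t. K t +> r t) \<in> carrier S"
proof -
  have "K (Suc t) +> r (Suc t) \<subseteq> K t +> r t" for t
  proof -
    have "r (Suc t) \<in> K t +> r t" using assms mem_coset_iff by simp
    then have "K t +> r t = K t +> r (Suc t)" using assms(1) coset_eqI by simp
    moreover have "K (Suc t) \<subseteq> K t" using ideal_pow_antimono[OF is_ideal, of t "Suc t"] by simp
    ultimately show ?thesis unfolding a_r_coset_def' by auto
  qed
  moreover have "K t +> r t \<in> carrier (R Quot K t)" for t
    using assms(1) unfolding FactRing_def A_RCOSETS_def' by auto
  ultimately show ?thesis unfolding adic_completion_def by simp
qed

lemma rep_mult:
  assumes "f \<in> carrier S" "g \<in> carrier S" "a \<in> f t" "b \<in> g t"
  shows "a \<otimes> b \<in> (f \<otimes>\<^bsub>S\<^esub> g) t"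
  using completion_eq_coset[OF assms(1,3)] completion_eq_coset[OF assms(2,4)]
    completion_rep_carrier[OF assms(1,3)] completion_rep_carrier[OF assms(2,4)]
  by (simp add: completion_simps quot_mult coset_self)

lemma rep_add:
  assumes "f \<in> carrier S" "g \<in> carrier S" "a \<in> f t" "b \<in> g t"
  shows "a \<oplus> b \<in> (f \<oplus>\<^bsub>S\<^esub> g) t"
  using completion_eq_coset[OF assms(1,3)] completion_eq_coset[OF assms(2,4)]
    completion_rep_carrier[OF assms(1,3)] completion_rep_carrier[OF assms(2,4)]
  by (simp add: completion_simps quot_add coset_self)

definition completion_map :: "'a \<Rightarrow> nat \<Rightarrow> 'a set" where
  "completion_map a = (\<lambda>t. K t +> a)"

lemma completion_map_closed: "a \<in> carrier R \<Longrightarrow> completion_map a \<in> carrier S"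
  unfolding completion_map_def
  by (rule limit_in_completion)
     (simp_all add: a_minus_def r_neg K_zero)

lemma completion_map_rep: "a \<in> carrier R \<Longrightarrow> a \<in> completion_map a t"
  by (simp add: completion_map_def coset_self)

text \<open>The inclusion \<open>f (Suc t) \<subseteq> f t\<close> lets one pair of representatives serve at two consecutive levels, so that an
  operation defined level by level through representatives gives a compatible family of cosets.\<close>

lemma completion_closedI:
  assumes f: "f \<in> carrier S" and g: "g \<in> carrier S"
    and h: "\<And>t a b. a \<in> f t \<Longrightarrow> b \<in> g t \<Longrightarrow> h t = K t +> p a b"
    and p: "\<And>a b. a \<in> carrier R \<Longrightarrow> b \<in> carrier R \<Longrightarrow> p a b \<in> carrier R"
  shows "h \<in> carrier S"
proof -
  have "h t \<in> carrier (R Quot K t) \<and> h (Suc t) \<subseteq> h t" for t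
  proof -
    obtain a where a: "a \<in> carrier R" "a \<in> f (Suc t)" using completion_rep[OF f] ..
    obtain b where b: "b \<in> carrier R" "b \<in> g (Suc t)" using completion_rep[OF g] ..
    have "a \<in> f t" "b \<in> g t"
      using a b completion_antimono[OF f, of t "Suc t"] completion_antimono[OF g, of t "Suc t"] by auto
    then have "h t = K t +> p a b" "h (Suc t) = K (Suc t) +> p a b"
      using h a b by simp_all
    moreover have "K (Suc t) \<subseteq> K t" using ideal_pow_antimono[OF is_ideal, of t "Suc t"] by simp
    ultimately show ?thesis using p[OF a(1) b(1)]
      unfolding a_r_coset_def' FactRing_def A_RCOSETS_def' by auto
  qed
  then show ?thesis by (simp add: adic_completion_def)
qed

lemma completion_cring: "cring S"
proof -
  interpret Q: cring "R Quot K t" for t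
    by (rule ideal.quotient_is_cring[OF K_ideal is_cring])
  have lev: "f t \<in> carrier (R Quot K t)" if "f \<in> carrier S" for f t
    using that by (simp add: adic_completion_def)
  have lev0: "\<zero>\<^bsub>S\<^esub> t = \<zero>\<^bsub>R Quot K t\<^esub>" "\<one>\<^bsub>S\<^esub> t = \<one>\<^bsub>R Quot K t\<^esub>" for t
    by (simp_all add: adic_completion_def)
  have mult: "f \<otimes>\<^bsub>S\<^esub> g \<in> carrier S" if f: "f \<in> carrier S" and g: "g \<in> carrier S" for f g
  proof (rule completion_closedI[OF f g])
    show "(f \<otimes>\<^bsub>S\<^esub> g) t = K t +> (a \<otimes> b)" if "a \<in> f t" "b \<in> g t" for t a b
      using completion_eq_coset[OF f that(1)] completion_eq_coset[OF g that(2)]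
        completion_rep_carrier[OF f that(1)] completion_rep_carrier[OF g that(2)]
      by (simp add: completion_simps quot_mult)
  qed simp
  have add: "f \<oplus>\<^bsub>S\<^esub> g \<in> carrier S" if f: "f \<in> carrier S" and g: "g \<in> carrier S" for f g
  proof (rule completion_closedI[OF f g])
    show "(f \<oplus>\<^bsub>S\<^esub> g) t = K t +> (a \<oplus> b)" if "a \<in> f t" "b \<in> g t" for t a b
      using completion_eq_coset[OF f that(1)] completion_eq_coset[OF g that(2)]
        completion_rep_carrier[OF f that(1)] completion_rep_carrier[OF g that(2)]
      by (simp add: completion_simps quot_add)
  qed simp
  have K0: "K t +> \<zero> = K t" for t by (rule a_rcos_zero[OF K_ideal K_zero])
  have one: "\<one>\<^bsub>S\<^esub> = completion_map \<one>" and zero: "\<zero>\<^bsub>S\<^esub> = completion_map \<zero>"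
    by (rule ext; simp add: completion_map_def completion_simps K0)+
  have neg: "\<exists>g\<in>carrier S. g \<oplus>\<^bsub>S\<^esub> f = \<zero>\<^bsub>S\<^esub>" if f: "f \<in> carrier S" for f
  proof (intro bexI ext)
    let ?g = "completion_map (\<ominus> \<one>) \<otimes>\<^bsub>S\<^esub> f"
    show "?g \<in> carrier S" by (intro mult completion_map_closed f) simp
    fix t
    obtain a where a: "a \<in> carrier R" "f t = K t +> a" using completion_level[OF f] ..
    have "\<ominus> \<one> \<otimes> a \<oplus> a = \<zero>" using a(1) by algebra
    then show "(?g \<oplus>\<^bsub>S\<^esub> f) t = \<zero>\<^bsub>S\<^esub> t"
      using a by (simp add: completion_simps completion_map_def quot_mult quot_add K0)
  qed
  show ?thesis
  proof (intro cringI abelian_groupI comm_monoidI)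
    fix f g h assume f: "f \<in> carrier S" and g: "g \<in> carrier S" and h: "h \<in> carrier S"
    note l = lev[OF f] lev[OF g] lev[OF h]
    show "f \<oplus>\<^bsub>S\<^esub> g \<oplus>\<^bsub>S\<^esub> h = f \<oplus>\<^bsub>S\<^esub> (g \<oplus>\<^bsub>S\<^esub> h)"
      by (rule ext) (simp add: completion_simps(1,2) l Q.a_assoc)
    show "f \<otimes>\<^bsub>S\<^esub> g \<otimes>\<^bsub>S\<^esub> h = f \<otimes>\<^bsub>S\<^esub> (g \<otimes>\<^bsub>S\<^esub> h)"
      by (rule ext) (simp add: completion_simps(1,2) l Q.m_assoc)
    show "(f \<oplus>\<^bsub>S\<^esub> g) \<otimes>\<^bsub>S\<^esub> h = f \<otimes>\<^bsub>S\<^esub> h \<oplus>\<^bsub>S\<^esub> g \<otimes>\<^bsub>S\<^esub> h"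
      by (rule ext) (simp add: completion_simps(1,2) l Q.l_distr)
  next
    fix f g assume f: "f \<in> carrier S" and g: "g \<in> carrier S"
    note l = lev[OF f] lev[OF g]
    show "f \<oplus>\<^bsub>S\<^esub> g \<in> carrier S" by (rule add[OF f g])
    show "f \<otimes>\<^bsub>S\<^esub> g \<in> carrier S" by (rule mult[OF f g])
    show "f \<oplus>\<^bsub>S\<^esub> g = g \<oplus>\<^bsub>S\<^esub> f"
      by (rule ext) (simp add: completion_simps(1,2) l Q.a_comm)
    show "f \<otimes>\<^bsub>S\<^esub> g = g \<otimes>\<^bsub>S\<^esub> f"
      by (rule ext) (simp add: completion_simps(1,2) l Q.m_comm)
  next
    fix f assume f: "f \<in> carrier S"
    note l = lev[OF f]
    show "\<zero>\<^bsub>S\<^esub> \<oplus>\<^bsub>S\<^esub> f = f" by (rule ext) (simp add: completion_simps(1,2) lev0 l)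
    show "\<one>\<^bsub>S\<^esub> \<otimes>\<^bsub>S\<^esub> f = f" by (rule ext) (simp add: completion_simps(1,2) lev0 l)
    show "\<exists>g\<in>carrier S. g \<oplus>\<^bsub>S\<^esub> f = \<zero>\<^bsub>S\<^esub>" by (rule neg[OF f])
  qed (simp_all add: one zero completion_map_closed)
qed

end

section \<open>Passing between a ring and its completion\<close>

context adic_ring
begin

sublocale S: cring S by (rule completion_cring)

lemma completion_map_hom: "ring_hom_cring R S completion_map"
proof -
  have "completion_map \<in> ring_hom R S"
  proof (rule ring_hom_memI)
    show "completion_map \<one> = \<one>\<^bsub>S\<^esub>"
      by (rule ext) (simp add: completion_map_def completion_simps)
  next
    fix a b assume "a \<in> carrier R" "b \<in> carrier R"
    then show "completion_map (a \<otimes> b) = completion_map a \<otimes>\<^bsub>S\<^esub> completion_map b"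
      "completion_map (a \<oplus> b) = completion_map a \<oplus>\<^bsub>S\<^esub> completion_map b"
      by (simp_all add: fun_eq_iff completion_simps completion_map_def quot_mult quot_add)
  qed (rule completion_map_closed)
  then show ?thesis
    by (intro ring_hom_cring.intro ring_hom_cring_axioms.intro is_cring S.is_cring)
qed

sublocale \<phi>: ring_hom_cring R S completion_map by (rule completion_map_hom)

lemma completion_level_add:
  assumes "f t = f' t" "g t = g' t"
  shows "(f \<oplus>\<^bsub>S\<^esub> g) t = (f' \<oplus>\<^bsub>S\<^esub> g') t"
  using assms by (simp add: completion_simps)

lemma completion_level_mult:
  assumes "f t = f' t" "g t = g' t"
  shows "(f \<otimes>\<^bsub>S\<^esub> g) t = (f' \<otimes>\<^bsub>S\<^esub> g') t"
  using assms by (simp add: completion_simps)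

lemma completion_level_down:
  assumes "f \<in> carrier S" "g \<in> carrier S" "f t = g t" "s \<le> t"
  shows "f s = g s"
proof -
  obtain a where "a \<in> f t" using completion_rep[OF assms(1)] by blast
  then have "a \<in> f s" "a \<in> g s"
    using completion_antimono[OF assms(1,4)] completion_antimono[OF assms(2,4)] assms(3) by auto
  then show ?thesis by (rule completion_eq_level[OF assms(1,2)])
qed

lemma rep_pow:
  assumes "f \<in> carrier S" "a \<in> f t"
  shows "a [^] (n::nat) \<in> (f [^]\<^bsub>S\<^esub> n) t"
proof (induct n)
  case 0
  show ?case by (simp add: completion_simps coset_self)
next
  case (Suc n)
  then show ?case using rep_mult[OF S.nat_pow_closed[OF assms(1)] assms(1) Suc assms(2)] by simp
qed

lemma rep_finsum:
  assumes "finite X" "\<And>i. i \<in> X \<Longrightarrow> f i \<in> carrier S" "\<And>i. i \<in> X \<Longrightarrow> a i \<in> f i t"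
  shows "finsum R a X \<in> (finsum S f X) t"
  using assms
proof (induct X)
  case empty
  show ?case using K_zero by (simp add: completion_simps)
next
  case (insert x X)
  have c: "a \<in> X \<rightarrow> carrier R" "a x \<in> carrier R" "f \<in> X \<rightarrow> carrier S" "f x \<in> carrier S"
    using insert.prems completion_rep_carrier[of "f _" "a _" t] by auto
  have "a x \<oplus> finsum R a X \<in> (f x \<oplus>\<^bsub>S\<^esub> finsum S f X) t"
    using insert.prems insert.hyps(3) by (intro rep_add c(4) S.finsum_closed c(3)) auto
  then show ?case using insert.hyps(1,2) c by simp
qed

text \<open>This lemma and the next are the two halves of the dictionary: reduction modulo \<open>I^t\<close> commutes with powers of
  ideals. They are stated for subsets because they are applied to integral closures as well as to ideals.\<close>

lemma rep_ideal_pow: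
  assumes A: "A \<subseteq> carrier S" and rep: "\<And>f. f \<in> A \<Longrightarrow> \<exists>r\<in>B. r \<in> f t"
    and f: "f \<in> ideal_pow S A n"
  shows "\<exists>r\<in>ideal_pow R B n. r \<in> f t"
  using f
proof (induct n arbitrary: f)
  case 0
  then show ?case using completion_rep by simp
next
  case (Suc n)
  have c: "ideal_pow S A (Suc n) \<subseteq> carrier S" "ideal_pow S A n \<subseteq> carrier S"
    by (rule S.ideal_pow_subset_carrier[OF A])+
  from Suc.prems have "f \<in> ideal_prod S A (ideal_pow S A n)" by simp
  then have "\<exists>r\<in>ideal_prod R B (ideal_pow R B n). r \<in> f t"
  proof induct
    case (prod i j)
    obtain r where r: "r \<in> B" "r \<in> i t" using rep[OF prod(1)] by blast
    obtain s where s: "s \<in> ideal_pow R B n" "s \<in> j t" using Suc.hyps[OF prod(2)] by blast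
    have "r \<otimes> s \<in> (i \<otimes>\<^bsub>S\<^esub> j) t"
      using prod A c by (intro rep_mult r s) auto
    then show ?case using ideal_prod.prod[of r B s "ideal_pow R B n" R, OF r(1) s(1)] by blast
  next
    case (sum f g)
    obtain r where r: "r \<in> ideal_prod R B (ideal_pow R B n)" "r \<in> f t" using sum by blast
    obtain s where s: "s \<in> ideal_prod R B (ideal_pow R B n)" "s \<in> g t" using sum by blast
    have "r \<oplus> s \<in> (f \<oplus>\<^bsub>S\<^esub> g) t"
      using sum c by (intro rep_add r s) auto
    then show ?case using ideal_prod.sum[OF r(1) s(1)] by blast
  qed
  then show ?case by simp
qed

lemma lift_ideal_pow:
  assumes A: "A \<subseteq> carrier S" and lift: "\<And>r. r \<in> B \<Longrightarrow> \<exists>f\<in>A. r \<in> f t"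
    and r: "r \<in> ideal_pow R B n"
  shows "\<exists>f\<in>ideal_pow S A n. r \<in> f t"
  using r
proof (induct n arbitrary: r)
  case 0
  then show ?case using completion_map_closed[of r] completion_map_rep[of r t] by (simp, blast)
next
  case (Suc n)
  have c: "ideal_pow S A (Suc n) \<subseteq> carrier S" "ideal_pow S A n \<subseteq> carrier S"
    by (rule S.ideal_pow_subset_carrier[OF A])+
  from Suc.prems have "r \<in> ideal_prod R B (ideal_pow R B n)" by simp
  then have "\<exists>f\<in>ideal_prod S A (ideal_pow S A n). r \<in> f t"
  proof induct
    case (prod i j)
    obtain f where f: "f \<in> A" "i \<in> f t" using lift[OF prod(1)] by blast
    obtain g where g: "g \<in> ideal_pow S A n" "j \<in> g t" using Suc.hyps[OF prod(2)] by blast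
    have "i \<otimes> j \<in> (f \<otimes>\<^bsub>S\<^esub> g) t"
      using f g A c by (intro rep_mult f g) auto
    then show ?case using ideal_prod.prod[of f A g "ideal_pow S A n" S, OF f(1) g(1)] by blast
  next
    case (sum i j)
    obtain f where f: "f \<in> ideal_prod S A (ideal_pow S A n)" "i \<in> f t" using sum by blast
    obtain g where g: "g \<in> ideal_prod S A (ideal_pow S A n)" "j \<in> g t" using sum by blast
    have "i \<oplus> j \<in> (f \<oplus>\<^bsub>S\<^esub> g) t"
      using f g c by (intro rep_add f g) auto
    then show ?case using ideal_prod.sum[OF f(1) g(1)] by blast
  qed
  then show ?case by simp
qed

text \<open>As \<open>j t\<close> is the coset of all representatives of \<open>j\<close> at level \<open>t\<close>, this is the preimage in \<open>R\<close> of the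
  image of \<open>J\<close> in \<open>R / I^t\<close>.\<close>

definition trunc_ideal :: "(nat \<Rightarrow> 'a set) set \<Rightarrow> nat \<Rightarrow> 'a set" where
  "trunc_ideal J t = (\<Union>j\<in>J. j t)"

lemma trunc_ideal:
  assumes "ideal J S"
  shows "ideal (trunc_ideal J t) R" "K t \<subseteq> trunc_ideal J t"
proof -
  interpret J: ideal J S by fact
  have "\<zero>\<^bsub>S\<^esub> t = K t" by (simp add: completion_simps)
  then show sub: "K t \<subseteq> trunc_ideal J t"
    unfolding trunc_ideal_def using J.zero_closed by blast
  show "ideal (trunc_ideal J t) R"
  proof (rule idealI_cring)
    show "trunc_ideal J t \<subseteq> carrier R"
      unfolding trunc_ideal_def using completion_rep_carrier J.Icarr by blast
    show "\<zero> \<in> trunc_ideal J t" using sub K_zero by blast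
    show "a \<oplus> b \<in> trunc_ideal J t" if ab: "a \<in> trunc_ideal J t" "b \<in> trunc_ideal J t" for a b
    proof -
      obtain f g where "f \<in> J" "a \<in> f t" "g \<in> J" "b \<in> g t"
        using ab unfolding trunc_ideal_def by blast
      then have "f \<oplus>\<^bsub>S\<^esub> g \<in> J" "a \<oplus> b \<in> (f \<oplus>\<^bsub>S\<^esub> g) t" by (auto intro: rep_add)
      then show ?thesis unfolding trunc_ideal_def by blast
    qed
    show "r \<otimes> a \<in> trunc_ideal J t" if r: "r \<in> carrier R" and a: "a \<in> trunc_ideal J t" for r a
    proof -
      obtain f where f: "f \<in> J" "a \<in> f t"
        using a unfolding trunc_ideal_def by blast
      have "completion_map r \<otimes>\<^bsub>S\<^esub> f \<in> J" "r \<otimes> a \<in> (completion_map r \<otimes>\<^bsub>S\<^esub> f) t"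
        using r f by (auto intro: rep_mult J.I_l_closed completion_map_rep)
      then show ?thesis unfolding trunc_ideal_def by blast
    qed
  qed
qed

text \<open>Represent an equation of integral dependence of degree \<open>N\<close> not at level \<open>t\<close> but at level \<open>t N\<close>. The
  representatives then satisfy it up to an error in \<open>I^(t N)\<close>, which lies in the \<open>N\<close>-th power of the truncated ideal
  because that ideal contains \<open>I^t\<close>. So the error can be absorbed into the constant coefficient.\<close>

lemma integral_closure_rep:
  assumes J: "ideal J S" and x: "x \<in> integral_closure S J"
  shows "\<exists>r\<in>integral_closure R (trunc_ideal J t). r \<in> x t"
proof -
  interpret J: ideal J S by fact
  have xc: "x \<in> carrier S" using x by (simp add: integral_closure_def)
  obtain N a where N: "N \<ge> 1" and a: "\<And>i. i \<in> {1..N} \<Longrightarrow> a i \<in> ideal_pow S J i"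
    and eq: "x [^]\<^bsub>S\<^esub> N \<oplus>\<^bsub>S\<^esub> (\<Oplus>\<^bsub>S\<^esub>i\<in>{1..N}. a i \<otimes>\<^bsub>S\<^esub> x [^]\<^bsub>S\<^esub> (N - i)) = \<zero>\<^bsub>S\<^esub>"
    using x unfolding integral_closure_def integral_over_ideal_def by blast
  have ac: "a i \<in> carrier S" if "i \<in> {1..N}" for i
    using a[OF that] S.ideal_pow_subset_carrier[OF J.a_subset] by blast
  define T where "T = t * N"
  have tT: "t \<le> T" using N unfolding T_def by simp
  obtain r where r: "r \<in> carrier R" "r \<in> x T" using completion_rep[OF xc] by blast
  have J': "ideal (trunc_ideal J t) R" by (rule trunc_ideal[OF J])
  have "\<exists>b\<in>ideal_pow R (trunc_ideal J t) i. b \<in> a i T" if "i \<in> {1..N}" for i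
  proof (rule rep_ideal_pow[OF J.a_subset _ a[OF that]])
    show "\<exists>r\<in>trunc_ideal J t. r \<in> f T" if "f \<in> J" for f
      using completion_rep[of f T] completion_antimono[OF _ tT, of f] that J.Icarr
      unfolding trunc_ideal_def by blast
  qed
  then obtain b where b: "\<And>i. i \<in> {1..N} \<Longrightarrow> b i \<in> ideal_pow R (trunc_ideal J t) i"
    and bT: "\<And>i. i \<in> {1..N} \<Longrightarrow> b i \<in> a i T" by metis
  have bc: "b i \<in> carrier R" if "i \<in> {1..N}" for i
    using completion_rep_carrier[OF ac[OF that] bT[OF that]] .
  define e where "e = r [^] N \<oplus> (\<Oplus>i\<in>{1..N}. b i \<otimes> r [^] (N - i))"
  have "e \<in> (x [^]\<^bsub>S\<^esub> N \<oplus>\<^bsub>S\<^esub> (\<Oplus>\<^bsub>S\<^esub>i\<in>{1..N}. a i \<otimes>\<^bsub>S\<^esub> x [^]\<^bsub>S\<^esub> (N - i))) T"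
    unfolding e_def using r bT ac xc
    by (intro rep_add rep_finsum rep_mult rep_pow S.finsum_closed) auto
  then have eK: "e \<in> K T" unfolding eq by (simp add: completion_simps)
  also have "K T = ideal_pow R (K t) N" unfolding T_def by (rule ideal_pow_ideal_pow[OF is_ideal, symmetric])
  also have "\<dots> \<subseteq> ideal_pow R (trunc_ideal J t) N" by (rule ideal_pow_mono[OF trunc_ideal(2)[OF J]])
  finally have e: "e \<in> ideal_pow R (trunc_ideal J t) N" .
  interpret P: ideal "ideal_pow R (trunc_ideal J t) N" R by (rule ideal_pow_is_ideal[OF J'])
  define b' where "b' = b(N := b N \<ominus> e)"
  have b': "b' i \<in> ideal_pow R (trunc_ideal J t) i" if "i \<in> {1..N}" for i
    using b[OF that] e unfolding b'_def by (auto simp: a_minus_def)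
  have split: "{1..N} = insert N {1..<N}" using N by auto
  have Nmem: "N \<in> {1..N}" using N by simp
  have sum': "(\<Oplus>i\<in>{1..<N}. b' i \<otimes> r [^] (N - i)) = (\<Oplus>i\<in>{1..<N}. b i \<otimes> r [^] (N - i))"
    using bc r(1) by (intro finsum_cong') (auto simp: b'_def)
  define s where "s = (\<Oplus>i\<in>{1..<N}. b i \<otimes> r [^] (N - i))"
  have sc: "s \<in> carrier R" unfolding s_def using bc r(1) by (intro finsum_closed) auto
  have bNc: "b N \<in> carrier R" by (rule bc[OF Nmem])
  have ec: "e \<in> carrier R" using e by (rule P.Icarr)
  have "(\<Oplus>i\<in>{1..N}. b i \<otimes> r [^] (N - i)) = b N \<otimes> r [^] (N - N) \<oplus> s"
    unfolding split s_def using bc r(1) bNc by (subst finsum_insert) auto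
  then have e_eq: "e = r [^] N \<oplus> (b N \<oplus> s)" unfolding e_def using bNc by simp
  have "(\<Oplus>i\<in>{1..N}. b' i \<otimes> r [^] (N - i)) = b' N \<otimes> r [^] (N - N) \<oplus> s"
    unfolding split s_def sum'[symmetric] using bc r(1) bNc ec
    by (subst finsum_insert) (auto simp: b'_def)
  also have "\<dots> = (b N \<ominus> e) \<oplus> s" using bNc ec by (simp add: b'_def)
  finally have "r [^] N \<oplus> (\<Oplus>i\<in>{1..N}. b' i \<otimes> r [^] (N - i)) = r [^] N \<oplus> ((b N \<ominus> e) \<oplus> s)" by simp
  also have "\<dots> = (r [^] N \<oplus> (b N \<oplus> s)) \<ominus> e"
    using nat_pow_closed[OF r(1), of N] bNc sc ec by algebra
  also have "\<dots> = \<zero>" unfolding e_eq[symmetric] using ec by (simp add: a_minus_def r_neg)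
  finally have "r \<in> integral_closure R (trunc_ideal J t)"
    unfolding integral_closure_def integral_over_ideal_def using r(1) N b' by blast
  moreover have "r \<in> x t" using completion_antimono[OF xc tT] r(2) by blast
  ultimately show ?thesis by blast
qed

lemma completion_map_ideal_pow:
  assumes A: "A \<subseteq> carrier R" and AB: "\<And>a. a \<in> A \<Longrightarrow> completion_map a \<in> B"
    and x: "x \<in> ideal_pow R A n"
  shows "completion_map x \<in> ideal_pow S B n"
  using x
proof (induct n arbitrary: x)
  case (Suc n)
  have c: "ideal_pow R A (Suc n) \<subseteq> carrier R" "ideal_pow R A n \<subseteq> carrier R"
    by (rule ideal_pow_subset_carrier[OF A])+
  from Suc.prems have "x \<in> ideal_prod R A (ideal_pow R A n)" by simp
  then have "completion_map x \<in> ideal_prod S B (ideal_pow S B n)"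
  proof induct
    case (prod i j)
    then have "completion_map (i \<otimes> j) = completion_map i \<otimes>\<^bsub>S\<^esub> completion_map j"
      using A c by (intro \<phi>.hom_mult) auto
    then show ?case using ideal_prod.prod[OF AB[OF prod(1)] Suc.hyps[OF prod(2)], of S] by simp
  next
    case (sum i j)
    then have "completion_map (i \<oplus> j) = completion_map i \<oplus>\<^bsub>S\<^esub> completion_map j"
      using c by (intro \<phi>.hom_add) auto
    then show ?case using ideal_prod.sum[OF sum(2,4)] by simp
  qed
  then show ?case by simp
qed simp

lemma completion_map_pow:
  "a \<in> carrier R \<Longrightarrow> completion_map (a [^] (n::nat)) = completion_map a [^]\<^bsub>S\<^esub> n"
  by (induct n) simp_all

lemma completion_map_integral_closure:
  assumes J: "ideal J R" and JJ': "\<And>a. a \<in> J \<Longrightarrow> completion_map a \<in> J'"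
    and x: "x \<in> integral_closure R J"
  shows "completion_map x \<in> integral_closure S J'"
proof -
  interpret J: ideal J R by fact
  obtain N a where xc: "x \<in> carrier R" and N: "N \<ge> 1" and a: "\<And>i. i \<in> {1..N} \<Longrightarrow> a i \<in> ideal_pow R J i"
    and eq: "x [^] N \<oplus> (\<Oplus>i\<in>{1..N}. a i \<otimes> x [^] (N - i)) = \<zero>"
    using x unfolding integral_closure_def integral_over_ideal_def by blast
  have ac: "a i \<in> carrier R" if "i \<in> {1..N}" for i
    using a[OF that] ideal_pow_subset_carrier[OF J.a_subset] by blast
  let ?a = "\<lambda>i. completion_map (a i)"
  have "completion_map (\<Oplus>i\<in>{1..N}. a i \<otimes> x [^] (N - i))
      = (\<Oplus>\<^bsub>S\<^esub>i\<in>{1..N}. completion_map (a i \<otimes> x [^] (N - i)))"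
    using ac xc by (subst \<phi>.hom_finsum) (auto simp: comp_def)
  also have "\<dots> = (\<Oplus>\<^bsub>S\<^esub>i\<in>{1..N}. ?a i \<otimes>\<^bsub>S\<^esub> completion_map x [^]\<^bsub>S\<^esub> (N - i))"
    using ac xc by (intro S.finsum_cong') (auto simp: completion_map_pow)
  finally have "completion_map x [^]\<^bsub>S\<^esub> N \<oplus>\<^bsub>S\<^esub> (\<Oplus>\<^bsub>S\<^esub>i\<in>{1..N}. ?a i \<otimes>\<^bsub>S\<^esub> completion_map x [^]\<^bsub>S\<^esub> (N - i))
      = completion_map (x [^] N \<oplus> (\<Oplus>i\<in>{1..N}. a i \<otimes> x [^] (N - i)))"
    using ac xc by (subst \<phi>.hom_add) (auto intro!: finsum_closed simp: completion_map_pow)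
  also have "\<dots> = \<zero>\<^bsub>S\<^esub>" unfolding eq by simp
  finally have "completion_map x [^]\<^bsub>S\<^esub> N
      \<oplus>\<^bsub>S\<^esub> (\<Oplus>\<^bsub>S\<^esub>i\<in>{1..N}. ?a i \<otimes>\<^bsub>S\<^esub> completion_map x [^]\<^bsub>S\<^esub> (N - i)) = \<zero>\<^bsub>S\<^esub>" .
  moreover have "\<forall>i\<in>{1..N}. ?a i \<in> ideal_pow S J' i"
    using completion_map_ideal_pow[OF J.a_subset JJ' a] by blast
  ultimately have "integral_over_ideal S J' (completion_map x)"
    unfolding integral_over_ideal_def using N by (intro exI[of _ N] exI[of _ ?a]) simp
  then show ?thesis unfolding integral_closure_def using xc by simp
qed

text \<open>The topological closure of the extension of \<open>J\<close> to the completion.\<close>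

definition extended_ideal :: "'a set \<Rightarrow> (nat \<Rightarrow> 'a set) set" where
  "extended_ideal J = {f \<in> carrier S. \<forall>t. \<exists>r\<in>J. r \<in> f t}"

lemma extended_ideal:
  assumes "ideal J R"
  shows "ideal (extended_ideal J) S"
proof (rule S.idealI_cring)
  interpret J: ideal J R by fact
  show "extended_ideal J \<subseteq> carrier S" unfolding extended_ideal_def by blast
  show "\<zero>\<^bsub>S\<^esub> \<in> extended_ideal J"
    unfolding extended_ideal_def using J.zero_closed K_zero by (simp add: completion_simps, blast)
  show "f \<oplus>\<^bsub>S\<^esub> g \<in> extended_ideal J" if f: "f \<in> extended_ideal J" and g: "g \<in> extended_ideal J" for f g
  proof -
    have c: "f \<in> carrier S" "g \<in> carrier S" using f g unfolding extended_ideal_def by auto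
    have "\<exists>r\<in>J. r \<in> (f \<oplus>\<^bsub>S\<^esub> g) t" for t
    proof -
      obtain r s where "r \<in> J" "r \<in> f t" "s \<in> J" "s \<in> g t"
        using f g unfolding extended_ideal_def by blast
      then show ?thesis using rep_add[OF c] J.a_closed by blast
    qed
    then show ?thesis using c unfolding extended_ideal_def by simp
  qed
  show "f \<otimes>\<^bsub>S\<^esub> g \<in> extended_ideal J" if f: "f \<in> carrier S" and g: "g \<in> extended_ideal J" for f g
  proof -
    have c: "g \<in> carrier S" using g unfolding extended_ideal_def by auto
    have "\<exists>r\<in>J. r \<in> (f \<otimes>\<^bsub>S\<^esub> g) t" for t
    proof -
      obtain r s where "r \<in> carrier R" "r \<in> f t" "s \<in> J" "s \<in> g t"
        using completion_rep[OF f, of t] g unfolding extended_ideal_def by blast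
      then show ?thesis using rep_mult[OF f c] J.I_l_closed by blast
    qed
    then show ?thesis using f c unfolding extended_ideal_def by simp
  qed
qed

end

section \<open>Finitely generated ideals of the completion are closed\<close>

context adic_ring
begin

text \<open>Closed means closed in the topology given by the kernels of the maps to \<open>R / I^t\<close>: the equation \<open>q t = x t\<close> says
  that \<open>q\<close> and \<open>x\<close> have the same image in \<open>R / I^t\<close>.\<close>

definition closed_ideal :: "(nat \<Rightarrow> 'a set) set \<Rightarrow> bool" where
  "closed_ideal Q \<longleftrightarrow> ideal Q S \<and> (\<forall>x\<in>carrier S. (\<forall>t. \<exists>q\<in>Q. q t = x t) \<longrightarrow> x \<in> Q)"

lemma closed_zero: "closed_ideal {\<zero>\<^bsub>S\<^esub>}"
  unfolding closed_ideal_def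
proof (intro conjI ballI impI)
  show "ideal {\<zero>\<^bsub>S\<^esub>} S" by (rule S.zeroideal)
  fix x assume "\<forall>t. \<exists>q\<in>{\<zero>\<^bsub>S\<^esub>}. q t = x t"
  then have "x = \<zero>\<^bsub>S\<^esub>" by (intro ext) simp
  then show "x \<in> {\<zero>\<^bsub>S\<^esub>}" by simp
qed

text \<open>To write \<open>x\<close> as \<open>p + c q\<close> with \<open>p\<close> in \<open>Q\<close> one has to find \<open>c\<close>. The following set collects the representatives
  at level \<open>t\<close> of those \<open>c\<close> that solve the problem at level \<open>t\<close>. When it is nonempty, it is a coset of the
  ideal of solutions of the homogeneous problem \<open>x = 0\<close>.\<close>

definition approx_coeffs :: "(nat \<Rightarrow> 'a set) set \<Rightarrow> (nat \<Rightarrow> 'a set) \<Rightarrow> (nat \<Rightarrow> 'a set) \<Rightarrow> nat \<Rightarrow> 'a set"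
  where "approx_coeffs Q q x t =
    {r. \<exists>c\<in>carrier S. \<exists>p\<in>Q. r \<in> c t \<and> (p \<oplus>\<^bsub>S\<^esub> c \<otimes>\<^bsub>S\<^esub> q) t = x t}"

lemma approx_coeffs_carrier: "approx_coeffs Q q x t \<subseteq> carrier R"
  unfolding approx_coeffs_def using completion_rep_carrier by blast

lemma approx_coeffs_add:
  assumes Q: "ideal Q S" and q: "q \<in> carrier S"
    and "r \<in> approx_coeffs Q q x t" "s \<in> approx_coeffs Q q y t"
  shows "r \<oplus> s \<in> approx_coeffs Q q (x \<oplus>\<^bsub>S\<^esub> y) t"
proof -
  interpret Q: ideal Q S by fact
  obtain c p where c: "c \<in> carrier S" "p \<in> Q" "r \<in> c t" "(p \<oplus>\<^bsub>S\<^esub> c \<otimes>\<^bsub>S\<^esub> q) t = x t"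
    using assms(3) unfolding approx_coeffs_def by blast
  obtain d p' where d: "d \<in> carrier S" "p' \<in> Q" "s \<in> d t" "(p' \<oplus>\<^bsub>S\<^esub> d \<otimes>\<^bsub>S\<^esub> q) t = y t"
    using assms(4) unfolding approx_coeffs_def by blast
  have "(p \<oplus>\<^bsub>S\<^esub> p') \<oplus>\<^bsub>S\<^esub> (c \<oplus>\<^bsub>S\<^esub> d) \<otimes>\<^bsub>S\<^esub> q = (p \<oplus>\<^bsub>S\<^esub> c \<otimes>\<^bsub>S\<^esub> q) \<oplus>\<^bsub>S\<^esub> (p' \<oplus>\<^bsub>S\<^esub> d \<otimes>\<^bsub>S\<^esub> q)"
    using c(1) d(1) q Q.Icarr[OF c(2)] Q.Icarr[OF d(2)] by algebra
  then have "((p \<oplus>\<^bsub>S\<^esub> p') \<oplus>\<^bsub>S\<^esub> (c \<oplus>\<^bsub>S\<^esub> d) \<otimes>\<^bsub>S\<^esub> q) t = (x \<oplus>\<^bsub>S\<^esub> y) t"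
    using completion_level_add[of "p \<oplus>\<^bsub>S\<^esub> c \<otimes>\<^bsub>S\<^esub> q" t x "p' \<oplus>\<^bsub>S\<^esub> d \<otimes>\<^bsub>S\<^esub> q" y, OF c(4) d(4)] by simp
  moreover have "r \<oplus> s \<in> (c \<oplus>\<^bsub>S\<^esub> d) t" by (rule rep_add) fact+
  moreover have "c \<oplus>\<^bsub>S\<^esub> d \<in> carrier S" "p \<oplus>\<^bsub>S\<^esub> p' \<in> Q" using c d by auto
  ultimately show ?thesis unfolding approx_coeffs_def by blast
qed

lemma approx_coeffs_smult:
  assumes Q: "ideal Q S" and q: "q \<in> carrier S"
    and "r \<in> approx_coeffs Q q x t" "s \<in> carrier R"
  shows "s \<otimes> r \<in> approx_coeffs Q q (completion_map s \<otimes>\<^bsub>S\<^esub> x) t"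
proof -
  interpret Q: ideal Q S by fact
  obtain c p where c: "c \<in> carrier S" "p \<in> Q" "r \<in> c t" "(p \<oplus>\<^bsub>S\<^esub> c \<otimes>\<^bsub>S\<^esub> q) t = x t"
    using assms(3) unfolding approx_coeffs_def by blast
  let ?s = "completion_map s"
  have s: "?s \<in> carrier S" using assms(4) by simp
  have "?s \<otimes>\<^bsub>S\<^esub> p \<oplus>\<^bsub>S\<^esub> (?s \<otimes>\<^bsub>S\<^esub> c) \<otimes>\<^bsub>S\<^esub> q = ?s \<otimes>\<^bsub>S\<^esub> (p \<oplus>\<^bsub>S\<^esub> c \<otimes>\<^bsub>S\<^esub> q)"
    using c(1) s q Q.Icarr[OF c(2)] by algebra
  then have "(?s \<otimes>\<^bsub>S\<^esub> p \<oplus>\<^bsub>S\<^esub> (?s \<otimes>\<^bsub>S\<^esub> c) \<otimes>\<^bsub>S\<^esub> q) t = (?s \<otimes>\<^bsub>S\<^esub> x) t"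
    using completion_level_mult[of ?s t ?s "p \<oplus>\<^bsub>S\<^esub> c \<otimes>\<^bsub>S\<^esub> q" x, OF refl c(4)] by simp
  moreover have "s \<otimes> r \<in> (?s \<otimes>\<^bsub>S\<^esub> c) t"
    using assms(4) by (intro rep_mult s c completion_map_rep)
  moreover have "?s \<otimes>\<^bsub>S\<^esub> c \<in> carrier S" "?s \<otimes>\<^bsub>S\<^esub> p \<in> Q" using c s Q.I_l_closed by auto
  ultimately show ?thesis unfolding approx_coeffs_def by blast
qed

lemma approx_coeffs_diff:
  assumes Q: "ideal Q S" and q: "q \<in> carrier S" and x: "x \<in> carrier S"
    and r: "r \<in> approx_coeffs Q q x t" and s: "s \<in> approx_coeffs Q q x t"
  shows "r \<ominus> s \<in> approx_coeffs Q q \<zero>\<^bsub>S\<^esub> t"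
proof -
  have "r \<oplus> \<ominus> \<one> \<otimes> s \<in> approx_coeffs Q q (x \<oplus>\<^bsub>S\<^esub> completion_map (\<ominus> \<one>) \<otimes>\<^bsub>S\<^esub> x) t"
    by (intro approx_coeffs_add[OF Q q r] approx_coeffs_smult[OF Q q s]) simp
  moreover have "r \<oplus> \<ominus> \<one> \<otimes> s = r \<ominus> s"
    using r s approx_coeffs_carrier by (simp add: l_minus a_minus_def subset_iff)
  moreover have "x \<oplus>\<^bsub>S\<^esub> completion_map (\<ominus> \<one>) \<otimes>\<^bsub>S\<^esub> x = \<zero>\<^bsub>S\<^esub>"
    using x by (simp add: S.l_minus S.r_neg)
  ultimately show ?thesis by simp
qed

lemma approx_coeffs_zero_ideal:
  assumes Q: "ideal Q S" and q: "q \<in> carrier S"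
  shows "ideal (approx_coeffs Q q \<zero>\<^bsub>S\<^esub> t) R"
proof (rule idealI_cring[OF approx_coeffs_carrier])
  interpret Q: ideal Q S by fact
  show "\<zero> \<in> approx_coeffs Q q \<zero>\<^bsub>S\<^esub> t"
    unfolding approx_coeffs_def using q K_zero[of t]
    by (intro CollectI bexI[of _ "\<zero>\<^bsub>S\<^esub>"] conjI) (auto simp: completion_simps(4))
  show "a \<oplus> b \<in> approx_coeffs Q q \<zero>\<^bsub>S\<^esub> t"
    if "a \<in> approx_coeffs Q q \<zero>\<^bsub>S\<^esub> t" "b \<in> approx_coeffs Q q \<zero>\<^bsub>S\<^esub> t" for a b
    using approx_coeffs_add[OF Q q that] by simp
  show "r \<otimes> a \<in> approx_coeffs Q q \<zero>\<^bsub>S\<^esub> t"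
    if "r \<in> carrier R" "a \<in> approx_coeffs Q q \<zero>\<^bsub>S\<^esub> t" for r a
    using approx_coeffs_smult[OF Q q that(2,1)] that(1) by simp
qed

lemma approx_coeffs_antimono:
  assumes Q: "ideal Q S" and q: "q \<in> carrier S" and x: "x \<in> carrier S" and st: "s \<le> t"
  shows "approx_coeffs Q q x t \<subseteq> approx_coeffs Q q x s"
proof
  interpret Q: ideal Q S by fact
  fix r assume "r \<in> approx_coeffs Q q x t"
  then obtain c p where c: "c \<in> carrier S" "p \<in> Q" "r \<in> c t" "(p \<oplus>\<^bsub>S\<^esub> c \<otimes>\<^bsub>S\<^esub> q) t = x t"
    unfolding approx_coeffs_def by blast
  have "p \<oplus>\<^bsub>S\<^esub> c \<otimes>\<^bsub>S\<^esub> q \<in> carrier S" using c q Q.Icarr by simp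
  then have "(p \<oplus>\<^bsub>S\<^esub> c \<otimes>\<^bsub>S\<^esub> q) s = x s"
    by (rule completion_level_down[of "p \<oplus>\<^bsub>S\<^esub> c \<otimes>\<^bsub>S\<^esub> q" x t s, OF _ x c(4) st])
  moreover have "r \<in> c s" using completion_antimono[OF c(1) st] c(3) by blast
  ultimately show "r \<in> approx_coeffs Q q x s" unfolding approx_coeffs_def using c by blast
qed

end

context noetherian_local_ring
begin

sublocale adic_ring R \<mm> by unfold_locales

text \<open>Let \<open>x\<close> be in the closure of \<open>Q + (q)\<close>. The sets \<open>C t\<close> of approximate coefficients form a descending sequence of
  nonempty cosets of ideals \<open>D t\<close>. For each \<open>j\<close> the chain \<open>D t + K j\<close> stabilizes, and therefore so does the image of
  \<open>C t\<close> modulo \<open>K j\<close>. Hence a coefficient at a late stage can be corrected by an element of \<open>K j\<close> to one at any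
  later stage, and a sequence of such corrections converges to some \<open>c\<close> that is right at all
  levels. Then \<open>x - c q\<close> is in the closure of \<open>Q\<close>, hence in \<open>Q\<close>.\<close>

lemma closed_add_cgenideal:
  assumes Q: "closed_ideal Q" and q: "q \<in> carrier S"
  shows "closed_ideal (Q <+>\<^bsub>S\<^esub> PIdl\<^bsub>S\<^esub> q)"
  unfolding closed_ideal_def
proof (intro conjI ballI impI)
  have QI: "ideal Q S" using Q unfolding closed_ideal_def by blast
  interpret Q: ideal Q S by fact
  show "ideal (Q <+>\<^bsub>S\<^esub> PIdl\<^bsub>S\<^esub> q) S" by (rule S.add_cgenideal[OF QI q])
  fix x assume x: "x \<in> carrier S" and "\<forall>t. \<exists>z\<in>Q <+>\<^bsub>S\<^esub> PIdl\<^bsub>S\<^esub> q. z t = x t"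
  then have approx: "\<exists>p\<in>Q. \<exists>c\<in>carrier S. (p \<oplus>\<^bsub>S\<^esub> c \<otimes>\<^bsub>S\<^esub> q) t = x t" for t
    unfolding Bex_def S.mem_add_cgenideal_iff by blast
  define C where "C = approx_coeffs Q q x"
  define D where "D = approx_coeffs Q q \<zero>\<^bsub>S\<^esub>"
  have D: "ideal (D t) R" for t unfolding D_def by (rule approx_coeffs_zero_ideal[OF QI q])
  have C_mono: "C t \<subseteq> C s" and D_mono: "D t \<subseteq> D s" if "s \<le> t" for s t
    unfolding C_def D_def using that x by (intro approx_coeffs_antimono[OF QI q]; simp)+
  have C_ne: "\<exists>r. r \<in> C t" for t
  proof -
    obtain p c where pc: "p \<in> Q" "c \<in> carrier S" "(p \<oplus>\<^bsub>S\<^esub> c \<otimes>\<^bsub>S\<^esub> q) t = x t" using approx by blast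
    obtain r where "r \<in> c t" using completion_rep[OF pc(2)] by blast
    then show ?thesis unfolding C_def approx_coeffs_def using pc by blast
  qed
  have Cc: "C t \<subseteq> carrier R" for t unfolding C_def by (rule approx_coeffs_carrier)
  have C_diff: "r \<ominus> s \<in> D t" if "r \<in> C t" "s \<in> C t" for r s t
    using approx_coeffs_diff[OF QI q x] that unfolding C_def D_def by blast
  have C_shift: "r \<oplus> d \<in> C t" if "r \<in> C t" "d \<in> D t" for r d t
    using approx_coeffs_add[OF QI q] that x unfolding C_def D_def by (metis S.r_zero)
  have DK: "ideal (D t <+>\<^bsub>R\<^esub> K j) R" for t j by (rule add_ideals[OF D K_ideal])
  have "\<exists>T. \<forall>t\<ge>T. D t <+>\<^bsub>R\<^esub> K j = D T <+>\<^bsub>R\<^esub> K j" for j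
  proof (rule descending_chain_stabilizes[OF DK])
    show "D (Suc t) <+>\<^bsub>R\<^esub> K j \<subseteq> D t <+>\<^bsub>R\<^esub> K j" for t
      using D_mono[of t "Suc t"] unfolding set_add_def' by auto
    show "K j \<subseteq> D t <+>\<^bsub>R\<^esub> K j" for t
    proof
      fix k assume k: "k \<in> K j"
      have "\<zero> \<in> D t" by (rule additive_subgroup.zero_closed[OF ideal.axioms(1)[OF D]])
      moreover have "k = \<zero> \<oplus> k" using ideal.Icarr[OF K_ideal k] by simp
      ultimately show "k \<in> D t <+>\<^bsub>R\<^esub> K j" using k unfolding set_add_def' by blast
    qed
  qed
  then obtain T where T: "\<And>j t. t \<ge> T j \<Longrightarrow> D t <+>\<^bsub>R\<^esub> K j = D (T j) <+>\<^bsub>R\<^esub> K j" by metis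
  \<comment> \<open>A monotone choice of stages: at \<open>\<tau> j\<close> the chain modulo \<open>K j\<close> is already stable, and
    \<open>j \<le> \<tau> j\<close> makes the limit a solution at every level.\<close>
  define \<tau> where "\<tau> j = (\<Sum>i\<le>j. T i + i)" for j
  have \<tau>_ge: "T j + j \<le> \<tau> j" for j unfolding \<tau>_def by (rule member_le_sum) auto
  have \<tau>_Suc: "\<tau> j \<le> \<tau> (Suc j)" for j unfolding \<tau>_def by simp
  have step: "\<exists>s. s \<in> C (\<tau> (Suc j)) \<and> s \<ominus> r \<in> K j" if r: "r \<in> C (\<tau> j)" for r j
  proof -
    obtain s where s: "s \<in> C (\<tau> (Suc j))" using C_ne by blast
    then have "r \<ominus> s \<in> D (\<tau> j)" using C_diff[OF r] C_mono[OF \<tau>_Suc] by blast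
    moreover have "\<zero> \<in> K j" by (rule K_zero)
    moreover have rs: "r \<in> carrier R" "s \<in> carrier R" using r s Cc by blast+
    moreover have "r \<ominus> s = (r \<ominus> s) \<oplus> \<zero>" using rs by simp
    ultimately have "r \<ominus> s \<in> D (\<tau> j) <+>\<^bsub>R\<^esub> K j" unfolding set_add_def' by blast
    also have "D (\<tau> j) <+>\<^bsub>R\<^esub> K j = D (\<tau> (Suc j)) <+>\<^bsub>R\<^esub> K j"
      using T[of j "\<tau> j"] T[of j "\<tau> (Suc j)"] \<tau>_ge[of j] \<tau>_Suc[of j] by simp
    finally obtain d k where dk: "d \<in> D (\<tau> (Suc j))" "k \<in> K j" "r \<ominus> s = d \<oplus> k"
      unfolding set_add_def' by blast
    have dkc: "d \<in> carrier R" "k \<in> carrier R"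
      using dk ideal.Icarr[OF D] ideal.Icarr[OF K_ideal] by blast+
    have "(s \<oplus> d) \<ominus> r = d \<ominus> (r \<ominus> s)" using rs dkc by algebra
    also have "\<dots> = \<ominus> k" unfolding dk(3) using dkc by algebra
    also have "\<dots> \<in> K j" using dk(2) additive_subgroup.a_inv_closed[OF ideal.axioms(1)[OF K_ideal]] by blast
    finally show ?thesis using C_shift[OF s dk(1)] by blast
  qed
  obtain r where r: "\<And>j. r j \<in> C (\<tau> j)" "\<And>j. r (Suc j) \<ominus> r j \<in> K j"
    using dependent_nat_choice[of "\<lambda>j r. r \<in> C (\<tau> j)" "\<lambda>j r s. s \<ominus> r \<in> K j"] C_ne step by metis
  have rc: "r j \<in> carrier R" for j using r(1) Cc by blast
  define c where "c = (\<lambda>t. K t +> r t)"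
  have c: "c \<in> carrier S" unfolding c_def by (rule limit_in_completion[OF rc r(2)])
  have cq: "c \<otimes>\<^bsub>S\<^esub> q \<in> carrier S" using c q by simp
  have "\<exists>p\<in>Q. p t = (x \<ominus>\<^bsub>S\<^esub> c \<otimes>\<^bsub>S\<^esub> q) t" for t
  proof -
    have "r t \<in> C t" using r(1)[of t] C_mono[of t "\<tau> t"] \<tau>_ge[of t] by auto
    then obtain c' p where p: "c' \<in> carrier S" "p \<in> Q" "r t \<in> c' t" "(p \<oplus>\<^bsub>S\<^esub> c' \<otimes>\<^bsub>S\<^esub> q) t = x t"
      unfolding C_def approx_coeffs_def by blast
    have "c t = c' t"
      using completion_eq_coset[OF p(1,3)] unfolding c_def by simp
    then have "(p \<oplus>\<^bsub>S\<^esub> c \<otimes>\<^bsub>S\<^esub> q) t = (p \<oplus>\<^bsub>S\<^esub> c' \<otimes>\<^bsub>S\<^esub> q) t"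
      by (intro completion_level_add completion_level_mult refl)
    then have "(p \<oplus>\<^bsub>S\<^esub> c \<otimes>\<^bsub>S\<^esub> q) t = x t" using p(4) by simp
    then have "((p \<oplus>\<^bsub>S\<^esub> c \<otimes>\<^bsub>S\<^esub> q) \<oplus>\<^bsub>S\<^esub> \<ominus>\<^bsub>S\<^esub> (c \<otimes>\<^bsub>S\<^esub> q)) t = (x \<oplus>\<^bsub>S\<^esub> \<ominus>\<^bsub>S\<^esub> (c \<otimes>\<^bsub>S\<^esub> q)) t"
      by (intro completion_level_add refl)
    moreover have "(p \<oplus>\<^bsub>S\<^esub> c \<otimes>\<^bsub>S\<^esub> q) \<oplus>\<^bsub>S\<^esub> \<ominus>\<^bsub>S\<^esub> (c \<otimes>\<^bsub>S\<^esub> q) = p"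
      using Q.Icarr[OF p(2)] cq by (simp add: S.a_assoc S.r_neg)
    ultimately show ?thesis using p(2) by (auto simp: a_minus_def)
  qed
  then have "x \<ominus>\<^bsub>S\<^esub> c \<otimes>\<^bsub>S\<^esub> q \<in> Q" using Q x cq unfolding closed_ideal_def by simp
  moreover have "x = (x \<ominus>\<^bsub>S\<^esub> c \<otimes>\<^bsub>S\<^esub> q) \<oplus>\<^bsub>S\<^esub> c \<otimes>\<^bsub>S\<^esub> q" using x c q by algebra
  ultimately show "x \<in> Q <+>\<^bsub>S\<^esub> PIdl\<^bsub>S\<^esub> q"
    unfolding S.mem_add_cgenideal_iff using c by blast
qed

lemma closed_Idl_finite:
  assumes "finite B" "B \<subseteq> carrier S"
  shows "closed_ideal (Idl\<^bsub>S\<^esub> B)"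
  using assms
proof (induct B)
  case empty
  have "Idl\<^bsub>S\<^esub> {} = {\<zero>\<^bsub>S\<^esub>}"
    using S.genideal_minimal[OF S.zeroideal, of "{}"]
      additive_subgroup.zero_closed[OF ideal.axioms(1)[OF S.genideal_ideal[of "{}"]]] by auto
  then show ?case using closed_zero by simp
next
  case (insert b B)
  then show ?case using closed_add_cgenideal[of "Idl\<^bsub>S\<^esub> B" b] by (simp add: S.Idl_insert)
qed

end

section \<open>Reduction to finitely generated ideals\<close>

text \<open>An element of a power of \<open>A\<close> involves only finitely many elements of \<open>A\<close>. Each of them lies in some \<open>a F\<close>, and as
  these sets grow with \<open>F\<close>, the union of the finitely many \<open>F\<close> serves for all of them. The general \<open>a\<close> covers
  ideals and integral closures of ideals alike.\<close>

lemma (in cring) ideal_pow_finite_support: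
  assumes elem: "\<And>x. x \<in> A \<Longrightarrow> \<exists>F\<subseteq>J. finite F \<and> x \<in> a F"
    and mono: "\<And>F G. F \<subseteq> G \<Longrightarrow> G \<subseteq> J \<Longrightarrow> a F \<subseteq> a G"
    and x: "x \<in> ideal_pow R A n"
  shows "\<exists>F\<subseteq>J. finite F \<and> x \<in> ideal_pow R (a F) n"
  using x
proof (induct n arbitrary: x)
  case 0
  then show ?case by (intro exI[of _ "{}"]) simp
next
  case (Suc n)
  from Suc.prems have "x \<in> ideal_prod R A (ideal_pow R A n)" by simp
  then have "\<exists>F\<subseteq>J. finite F \<and> x \<in> ideal_prod R (a F) (ideal_pow R (a F) n)"
  proof induct
    case (prod i j)
    obtain F where F: "F \<subseteq> J" "finite F" "i \<in> a F" using elem[OF prod(1)] by blast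
    obtain G where G: "G \<subseteq> J" "finite G" "j \<in> ideal_pow R (a G) n" using Suc.hyps[OF prod(2)] by blast
    have "i \<in> a (F \<union> G)" "j \<in> ideal_pow R (a (F \<union> G)) n"
      using F(3) G(3) mono[of F "F \<union> G"] ideal_pow_mono[OF mono[of G "F \<union> G"]] F(1) G(1) by auto
    then show ?case
      using F G by (intro exI[of _ "F \<union> G"]) (auto intro: ideal_prod.prod)
  next
    case (sum i j)
    obtain F where F: "F \<subseteq> J" "finite F" "i \<in> ideal_prod R (a F) (ideal_pow R (a F) n)"
      using sum by blast
    obtain G where G: "G \<subseteq> J" "finite G" "j \<in> ideal_prod R (a G) (ideal_pow R (a G) n)"
      using sum by blast
    have "i \<in> ideal_prod R (a (F \<union> G)) (ideal_pow R (a (F \<union> G)) n)"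
      using F(3) ideal_pow_mono[OF mono[of F "F \<union> G"], of R "Suc n"] F(1) G(1) by auto
    moreover have "j \<in> ideal_prod R (a (F \<union> G)) (ideal_pow R (a (F \<union> G)) n)"
      using G(3) ideal_pow_mono[OF mono[of G "F \<union> G"], of R "Suc n"] F(1) G(1) by auto
    ultimately show ?case
      using F G by (intro exI[of _ "F \<union> G"]) (auto intro: ideal_prod.sum)
  qed
  then show ?case by simp
qed

lemma integral_closure_mono:
  assumes "A \<subseteq> B"
  shows "integral_closure R A \<subseteq> integral_closure R B"
  using ideal_pow_mono[OF assms, of R] unfolding integral_closure_def integral_over_ideal_def by blast

lemma (in cring) ideal_pow_finitely_generated_support:
  assumes J: "ideal J R" and x: "x \<in> ideal_pow R J n"
  shows "\<exists>F\<subseteq>J. finite F \<and> x \<in> ideal_pow R (Idl F) n"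
proof (rule ideal_pow_finite_support[OF _ _ x])
  interpret J: ideal J R by fact
  show "\<exists>F\<subseteq>J. finite F \<and> y \<in> Idl F" if "y \<in> J" for y
    using that genideal_self'[of y] J.Icarr by (intro exI[of _ "{y}"]) simp
  show "Idl F \<subseteq> Idl G" if "F \<subseteq> G" "G \<subseteq> J" for F G
    using that J.a_subset by (intro subset_Idl_subset) auto
qed

lemma (in cring) integral_closure_finitely_generated_support:
  assumes J: "ideal J R" and x: "x \<in> integral_closure R J"
  shows "\<exists>F\<subseteq>J. finite F \<and> x \<in> integral_closure R (Idl F)"
proof -
  interpret J: ideal J R by fact
  obtain N a where xc: "x \<in> carrier R" and N: "N \<ge> 1" and a: "\<And>i. i \<in> {1..N} \<Longrightarrow> a i \<in> ideal_pow R J i"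
    and eq: "x [^] N \<oplus> (\<Oplus>i\<in>{1..N}. a i \<otimes> x [^] (N - i)) = \<zero>"
    using x unfolding integral_closure_def integral_over_ideal_def by blast
  have "\<forall>i\<in>{1..N}. \<exists>F\<subseteq>J. finite F \<and> a i \<in> ideal_pow R (Idl F) i"
    using ideal_pow_finitely_generated_support[OF J a] by blast
  then obtain F where F: "\<And>i. i \<in> {1..N} \<Longrightarrow> F i \<subseteq> J \<and> finite (F i) \<and> a i \<in> ideal_pow R (Idl (F i)) i"
    by metis
  define G where "G = (\<Union>i\<in>{1..N}. F i)"
  have G: "G \<subseteq> J" "finite G" unfolding G_def using F by (blast, simp)
  have "a i \<in> ideal_pow R (Idl G) i" if i: "i \<in> {1..N}" for i
  proof -
    have "Idl (F i) \<subseteq> Idl G"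
      using i G(1) J.a_subset by (intro subset_Idl_subset) (auto simp: G_def)
    then show ?thesis using F[OF i] ideal_pow_mono by blast
  qed
  then have "x \<in> integral_closure R (Idl G)"
    unfolding integral_closure_def integral_over_ideal_def using xc N eq by blast
  then show ?thesis using G by blast
qed

lemma (in cring) ideal_pow_Idl_finite:
  assumes "finite F" "F \<subseteq> carrier R"
  shows "\<exists>B\<subseteq>carrier R. finite B \<and> ideal_pow R (Idl F) n = Idl B"
proof (induct n)
  case 0
  show ?case using genideal_one by (intro exI[of _ "{\<one>}"]) simp
next
  case (Suc n)
  then obtain B where B: "B \<subseteq> carrier R" "finite B" "ideal_pow R (Idl F) n = Idl B" by blast
  let ?C = "{a \<otimes> b | a b. a \<in> F \<and> b \<in> B}"
  have "?C = (\<lambda>(a, b). a \<otimes> b) ` (F \<times> B)" by auto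
  then have "finite ?C" using assms B by simp
  moreover have "?C \<subseteq> carrier R" using assms B by auto
  ultimately show ?case using ideal_prod_Idl[OF assms(2) B(1)] B(3) by (intro exI[of _ ?C]) simp
qed

section \<open>Comparison of the integral dimensions\<close>

context noetherian_local_ring
begin

text \<open>After \<open>J\<close> has been replaced by a finitely generated ideal \<open>P\<close>, the bound is applied at each level to the truncation of \<open>P\<close>.
  This places \<open>x\<close> in the closure of a power of \<open>P\<close>, which is finitely generated and hence closed.\<close>

lemma completion_integral_bound:
  assumes k: "\<And>J n. ideal J R \<Longrightarrow> n \<ge> k \<Longrightarrow> ideal_pow R (integral_closure R J) n \<subseteq> ideal_pow R J (n - k)"
    and J: "ideal J S" and n: "n \<ge> k"
  shows "ideal_pow S (integral_closure S J) n \<subseteq> ideal_pow S J (n - k)"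
proof
  fix x assume x: "x \<in> ideal_pow S (integral_closure S J) n"
  interpret J: ideal J S by fact
  have "\<exists>F\<subseteq>J. finite F \<and> x \<in> ideal_pow S (integral_closure S (Idl\<^bsub>S\<^esub> F)) n"
  proof (rule S.ideal_pow_finite_support[OF _ _ x])
    show "\<exists>F\<subseteq>J. finite F \<and> y \<in> integral_closure S (Idl\<^bsub>S\<^esub> F)" if "y \<in> integral_closure S J" for y
      by (rule S.integral_closure_finitely_generated_support[OF J that])
    show "integral_closure S (Idl\<^bsub>S\<^esub> F) \<subseteq> integral_closure S (Idl\<^bsub>S\<^esub> G)" if "F \<subseteq> G" "G \<subseteq> J" for F G
      using that J.a_subset by (intro integral_closure_mono S.subset_Idl_subset) auto
  qed
  then obtain F where F: "F \<subseteq> J" "finite F" and xF: "x \<in> ideal_pow S (integral_closure S (Idl\<^bsub>S\<^esub> F)) n"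
    by blast
  have Fc: "F \<subseteq> carrier S" using F J.a_subset by blast
  define P where "P = Idl\<^bsub>S\<^esub> F"
  have P: "ideal P S" unfolding P_def by (rule S.genideal_ideal[OF Fc])
  have PJ: "P \<subseteq> J" unfolding P_def by (rule S.genideal_minimal[OF J F(1)])
  have Pc: "P \<subseteq> carrier S" using PJ J.a_subset by blast
  have clc: "integral_closure S P \<subseteq> carrier S" unfolding integral_closure_def by blast
  have xc: "x \<in> carrier S"
    using xF S.ideal_pow_subset_carrier[OF clc] unfolding P_def by blast
  obtain B where B: "finite B" "B \<subseteq> carrier S" "ideal_pow S P (n - k) = Idl\<^bsub>S\<^esub> B"
    using S.ideal_pow_Idl_finite[OF F(2) Fc] unfolding P_def by blast
  have closed: "closed_ideal (ideal_pow S P (n - k))" unfolding B(3) by (rule closed_Idl_finite[OF B(1,2)])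
  have "\<exists>q\<in>ideal_pow S P (n - k). q t = x t" for t
  proof -
    have "\<exists>r\<in>ideal_pow R (integral_closure R (trunc_ideal P t)) n. r \<in> x t"
      by (rule rep_ideal_pow[OF clc integral_closure_rep[OF P] xF[folded P_def]])
    then obtain r where r: "r \<in> ideal_pow R (trunc_ideal P t) (n - k)" "r \<in> x t"
      using k[OF trunc_ideal(1)[OF P] n] by blast
    have "\<exists>f\<in>ideal_pow S P (n - k). r \<in> f t"
      by (rule lift_ideal_pow[OF Pc _ r(1)]) (auto simp: trunc_ideal_def)
    then obtain f where f: "f \<in> ideal_pow S P (n - k)" "r \<in> f t" by blast
    have "f \<in> carrier S" using f(1) S.ideal_pow_subset_carrier[OF Pc] by blast
    then have "f t = x t" by (rule completion_eq_level[of f x r t, OF _ xc f(2) r(2)])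
    then show ?thesis using f by blast
  qed
  then have "x \<in> ideal_pow S P (n - k)" using closed xc unfolding closed_ideal_def by blast
  then show "x \<in> ideal_pow S J (n - k)" using ideal_pow_mono[OF PJ] by blast
qed

text \<open>The bound in the completion shows that \<open>x\<close> is approximated to every order by elements of \<open>J^(n-k)\<close>, and the Krull
  intersection theorem applies.\<close>

lemma integral_bound_of_completion:
  assumes k: "\<And>J n. ideal J S \<Longrightarrow> n \<ge> k \<Longrightarrow> ideal_pow S (integral_closure S J) n \<subseteq> ideal_pow S J (n - k)"
    and J: "ideal J R" and n: "n \<ge> k"
  shows "ideal_pow R (integral_closure R J) n \<subseteq> ideal_pow R J (n - k)"
proof
  interpret J: ideal J R by fact
  fix x assume x: "x \<in> ideal_pow R (integral_closure R J) n"
  have clc: "integral_closure R J \<subseteq> carrier R" unfolding integral_closure_def by blast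
  have xc: "x \<in> carrier R" using x ideal_pow_subset_carrier[OF clc] by blast
  have ext: "completion_map a \<in> extended_ideal J" if "a \<in> J" for a
    unfolding extended_ideal_def using that completion_map_rep[of a] J.Icarr[OF that] by auto
  have "completion_map x \<in> ideal_pow S (integral_closure S (extended_ideal J)) n"
    by (rule completion_map_ideal_pow[OF clc completion_map_integral_closure[OF J ext] x])
  then have mem: "completion_map x \<in> ideal_pow S (extended_ideal J) (n - k)"
    using k[OF extended_ideal[OF J] n] by blast
  show "x \<in> ideal_pow R J (n - k)"
  proof (rule Krull_intersection[OF ideal_pow_is_ideal[OF J] xc])
    fix t
    have "\<exists>r\<in>ideal_pow R J (n - k). r \<in> completion_map x t"
      by (rule rep_ideal_pow[OF _ _ mem]) (auto simp: extended_ideal_def)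
    then obtain r where r: "r \<in> ideal_pow R J (n - k)" "r \<in> completion_map x t" by blast
    have "x \<ominus> r \<in> K t"
      using completion_rep_diff[OF completion_map_closed[OF xc] r(2) completion_map_rep[OF xc]] .
    then show "\<exists>q\<in>ideal_pow R J (n - k). x \<ominus> q \<in> K t" using r by blast
  qed
qed

end

theorem proposition2p8:
  fixes R :: "('a, 'b) ring_scheme" and \<mm> :: "'a set"
  assumes "noetherian_ring R"
    and "local_ring R \<mm>"
  shows "integral_dimension R = integral_dimension (adic_completion R \<mm>)"
proof -
  interpret noetherian_local_ring R \<mm>
    using assms by (rule noetherian_local_ring.intro)
  have "(\<forall>J n. ideal J R \<longrightarrow> n \<ge> k \<longrightarrow> ideal_pow R (integral_closure R J) n \<subseteq> ideal_pow R J (n - k))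
    \<longleftrightarrow> (\<forall>J n. ideal J S \<longrightarrow> n \<ge> k \<longrightarrow> ideal_pow S (integral_closure S J) n \<subseteq> ideal_pow S J (n - k))" for k
    using completion_integral_bound[of k] integral_bound_of_completion[of k] by meson
  then show ?thesis unfolding integral_dimension_def by simp
qed

end
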